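(* Let $Q$ be a fixed full conjunctive query with key order $\pi$, and let $\ell=r_\pi(Q)$ be the rank of $Q$ for $\pi$. Let $|I|$ denote the combined size of the input relations (with $|I|\ge M$) and $K$ the size of the output. If no spills occur during a boxed execution of Leapfrog Triejoin (boxed LFTJ) for $Q$ with key order $\pi$, then the total I/O cost is $$O\!\left(\frac{|I|^{\ell}}{M^{\ell-1}B}+\frac{K}{B}\right).$$
   Context: **Cost model.** Main memory holds $M$ words (one atomic value per word); secondary storage is read/written in blocks of $B$ words, each block read or write costing 1 I/O. Data complexity is used: the query is fixed, and constants in $O(\cdot)$ may depend on it. Standing assumptions: $|I|/B>\log|I|$, and $M/B$ is larger than, say, 10 times the number of atoms times their maximum arity. The setting is out-of-core: the input does not fit in main memory. **Queries.** A full conjunctive query $Q(x_1,\dots,x_n)\leftarrow A_1,\dots,A_m$ has body atoms $A_j$ over relation symbols and all body variables in its head. A key order (variable order) $\pi=x_1,\dots,x_n$ is fixed; no variable occurs twice in an atom, and the arguments of each atom form a subsequence of $\pi$. **Rank.** The rank $r_\pi(Q)$ of a query $Q$ conforming to the key order $\pi=x_1,\dots,x_n$ is the largest $j$ for which $Q$ contains an atom with $x_j$ as first variable. **In-memory LFTJ.** Backtracking search: at depth $i$, with $x_1,\dots,x_{i-1}$ bound, it enumerates in increasing order the intersection, over all atoms containing $x_i$, of the sets of values of $x_i$ occurring in tuples of that atom's relation that agree with the current binding on the earlier variables of the atom. For each value found it goes to depth $i+1$; at depth $n$ it outputs the tuple. Every output tuple is produced once. **TrieArrays and slices.** The trie of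 a $k$-ary relation $R$ stores each tuple as a root-to-leaf path, with distinct increasingly ordered children at each node. Its TrieArray consists of value arrays $\mathbf{val}_0,\dots,\mathbf{val}_{k-1}$ ($\mathbf{val}_i$ lists the trie nodes of the $i$-th column in lexicographic order) and index arrays $\mathbf{idx}_0,\dots,\mathbf{idx}_{k-2}$, where $\mathbf{idx}_i[j]$ is the position in $\mathbf{val}_{i+1}$ at which the children of node $\mathbf{val}_i[j]$ start (they end just before position $\mathbf{idx}_i[j+1]$). Input relations are given on secondary storage as TrieArrays consistent with $\pi$. For a tuple $s$ of length $p$ and values $l,h$, the slice $R^s_{l\to h}$ is $\{(t_0,\dots,t_{k-1})\in R : (t_0,\dots,t_{p-1})=s,\ l\le t_p\le h\}$. *Provisioning* a slice means copying its TrieArray (contiguous ranges of the arrays of $R$, with offset-adjusted index arrays) into memory. *Probing* $R$ with $s$, $l$ and a budget of $b$ blocks returns the maximal $h\ge l$ such that $R^s_{l\to h}$ occupies at most $b$ blocks, or SPILL if no such $h$ exists. Upper-bound values are found by binary search in the value arrays. **Boxed LFTJ.** The available memory is divided evenly among the $n$ dimensions (a constant-size output buffer is kept for writing the output append-only; memory unused at one dimension may be passed to the next). Each atom is assigned to the dimension $i$ such that $x_i$ is its first variable; let $\mathrm{atoms}[i]$ be this set. The recursive procedure BoxUp$(i)$, started with BoxUp$(1)$, sets $\mathrm{low}[i]=-\infty$ and repeats: (1) divide the memory of dimension $i$ evenly among all atoms to be handled at dimension $i$ (those in $\mathrm{atoms}[i]$ plus atoms spilled from earlier dimensions whose next attribute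 is $x_i$), and probe each from $\mathrm{low}[i]$ (with start tuple empty for atoms in $\mathrm{atoms}[i]$, and equal to the fixed prefix for spilled atoms); let $\mathrm{high}[i]$ be the minimum of the returned upper bounds; if an atom returns SPILL, set $\mathrm{high}[i]=\mathrm{low}[i]$ and mark this atom, restricted to its current attribute having the value $\mathrm{low}[i]$, as spilled, to be handled instead at the dimension of its next attribute; (2) provision the slices from $\mathrm{low}[i]$ to $\mathrm{high}[i]$ of all non-spilled atoms handled at dimension $i$ (blocks at slice boundaries are cached so that one complete pass reads each input block once); (3) if $i<n$ call BoxUp$(i+1)$, otherwise run in-memory LFTJ on all currently provisioned slices, i.e. on the box $\prod_j[\mathrm{low}[j],\mathrm{high}[j]]$; (4) set $\mathrm{low}[i]$ to the successor of $\mathrm{high}[i]$; until $\mathrm{high}[i]=\infty$. "No spills occur" means that no probe during the execution returns SPILL. *)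

theory Defs
  imports Complex_Main "HOL-Library.Sublist" "HOL-Library.List_Lexorder" "HOL-Library.Extended"
begin

section \<open>Queries\<close>

text \<open>
  An atom is a relation symbol with its argument list.  Atomic values are integers, so that every
  value has a successor; the bounds \<open>-\<infinity>\<close> and \<open>\<infinity>\<close> are \<open>Minf\<close> and \<open>Pinf\<close> of type \<^typ>\<open>int extended\<close>.
\<close>

type_synonym ('r, 'v) atom = "'r \<times> 'v list"

definition full_query :: "('r \<Rightarrow> nat) \<Rightarrow> ('r, 'v) atom list \<Rightarrow> 'v list \<Rightarrow> bool" where
  "full_query ar Q \<pi> \<longleftrightarrow>
     Q \<noteq> [] \<and> distinct \<pi> \<and> set \<pi> = (\<Union>(R, xs)\<in>set Q. set xs) \<and>
     (\<forall>(R, xs)\<in>set Q. xs \<noteq> [] \<and> length xs = ar R \<and> subseq xs \<pi>)"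

definition rank :: "('r, 'v) atom list \<Rightarrow> 'v list \<Rightarrow> nat" where
  "rank Q \<pi> = Max {j. 1 \<le> j \<and> j \<le> length \<pi> \<and> (\<exists>(R, xs)\<in>set Q. hd xs = \<pi> ! (j - 1))}"

definition database :: "('r \<Rightarrow> nat) \<Rightarrow> ('r, 'v) atom list \<Rightarrow> ('r \<Rightarrow> int list set) \<Rightarrow> bool" where
  "database ar Q D \<longleftrightarrow> (\<forall>R\<in>fst ` set Q. finite (D R) \<and> (\<forall>t\<in>D R. length t = ar R))"

definition answers :: "('r, 'v) atom list \<Rightarrow> 'v list \<Rightarrow> ('r \<Rightarrow> int list set) \<Rightarrow> int list set" where
  "answers Q \<pi> D = {u. length u = length \<pi> \<and>
     (\<forall>(R, xs)\<in>set Q. map (\<lambda>x. the (map_of (zip \<pi> u) x)) xs \<in> D R)}"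

section \<open>TrieArrays\<close>

text \<open>A trie node of the \<open>i\<close>-th column is identified with the path from the root to it, a list of
  length \<open>i + 1\<close>.  Lists are ordered lexicographically.\<close>

definition trie_level :: "int list set \<Rightarrow> nat \<Rightarrow> int list set" where
  "trie_level R i = take (Suc i) ` R"

definition val :: "int list set \<Rightarrow> nat \<Rightarrow> int list" where
  "val R i = map last (sorted_list_of_set (trie_level R i))"

text \<open>The last entry of an index array is a sentinel, which ends the children of the last node.\<close>

definition idx :: "int list set \<Rightarrow> nat \<Rightarrow> nat list" where
  "idx R i =
     map (\<lambda>u. card {w \<in> trie_level R (Suc i). take (Suc i) w < u})
       (sorted_list_of_set (trie_level R i))
     @ [card (trie_level R (Suc i))]"

definition trie_words :: "nat \<Rightarrow> int list set \<Rightarrow> nat" where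
  "trie_words k R = (\<Sum>i<k. length (val R i)) + (\<Sum>i<k - 1. length (idx R i))"

text \<open>Sizes are counted in words of the TrieArrays; a symbol used by several atoms is stored once.\<close>

definition input_size :: "('r \<Rightarrow> nat) \<Rightarrow> ('r, 'v) atom list \<Rightarrow> ('r \<Rightarrow> int list set) \<Rightarrow> nat" where
  "input_size ar Q D = (\<Sum>R\<in>fst ` set Q. trie_words (ar R) (D R))"

definition slice :: "int list set \<Rightarrow> int list \<Rightarrow> int extended \<Rightarrow> int extended \<Rightarrow> int list set" where
  "slice R s l h = {t \<in> R. take (length s) t = s \<and>
     l \<le> Fin (t ! length s) \<and> Fin (t ! length s) \<le> h}"

definition occupied_blocks :: "nat \<Rightarrow> nat \<Rightarrow> int list set \<Rightarrow> nat" where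
  "occupied_blocks B k R = nat \<lceil>real (trie_words k R) / real B\<rceil>"

text \<open>\<open>None\<close> stands for SPILL.\<close>

definition probe ::
    "nat \<Rightarrow> nat \<Rightarrow> nat \<Rightarrow> int list set \<Rightarrow> int list \<Rightarrow> int extended \<Rightarrow> int extended option" where
  "probe B b k R s l =
     (let fits = (\<lambda>h. l \<le> h \<and> occupied_blocks B k (slice R s l h) \<le> b)
      in if \<exists>h. fits h then Some (GREATEST h. fits h) else None)"

section \<open>Accesses to the stored arrays\<close>

datatype column = Val nat | Idx nat

text \<open>
  \<open>slice_start R s l\<close> and \<open>slice_end R s h\<close> are the positions in \<open>val R (length s)\<close> where the children
  of \<open>s\<close> with value at least \<open>l\<close> begin and just after the children of \<open>s\<close> with value at most \<open>h\<close>.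
  If \<open>a\<close> is a position in column \<open>p\<close>, then \<open>descend R p d a\<close> is the position in column \<open>p + d\<close> where
  the descendants of node \<open>a\<close> begin.
\<close>

definition slice_start :: "int list set \<Rightarrow> int list \<Rightarrow> int extended \<Rightarrow> nat" where
  "slice_start R s l = card {u \<in> trie_level R (length s).
     take (length s) u < s \<or> take (length s) u = s \<and> Fin (last u) < l}"

definition slice_end :: "int list set \<Rightarrow> int list \<Rightarrow> int extended \<Rightarrow> nat" where
  "slice_end R s h = card {u \<in> trie_level R (length s).
     take (length s) u < s \<or> take (length s) u = s \<and> Fin (last u) \<le> h}"

fun descend :: "int list set \<Rightarrow> nat \<Rightarrow> nat \<Rightarrow> nat \<Rightarrow> nat" where
  "descend R p 0 a = a"
| "descend R p (Suc d) a = idx R (p + d) ! descend R p d a"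

text \<open>Binary search in \<open>{lo..<hi}\<close> for the first position violating the downward closed predicate
  \<open>P\<close>: the list of examined positions, and the result (\<open>hi\<close> if there is none).\<close>

function bsearch :: "(nat \<Rightarrow> bool) \<Rightarrow> nat \<Rightarrow> nat \<Rightarrow> nat list \<times> nat" where
  "bsearch P lo hi =
     (if lo < hi then
        let m = (lo + hi) div 2;
            (ms, r) = (if P m then bsearch P (Suc m) hi else bsearch P lo m)
        in (m # ms, r)
      else ([], lo))"
  by pat_completeness auto
termination
  by (relation "measure (\<lambda>(P, lo, hi). hi - lo)") auto

declare bsearch.simps [simp del]

text \<open>
  The words read by a probe with budget \<open>b\<close>.  The position of the lower bound is known from the
  preceding slice (for a nonempty prefix \<open>s\<close>, the child range of \<open>s\<close> is looked up first), and more
  than \<open>b * B\<close> consecutive values cannot fit.  So the largest fitting value is searched for in a window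
  of that size.  Whether the slice up to the value at position \<open>m\<close> fits is determined by following
  the index arrays from both ends of the slice, stopping as soon as some column exceeds the budget.
\<close>

definition search_window ::
    "nat \<Rightarrow> nat \<Rightarrow> int list set \<Rightarrow> int list \<Rightarrow> int extended \<Rightarrow> nat" where
  "search_window B b R s l = min (slice_end R s Pinf) (slice_start R s l + b * B)"

definition extent_reads ::
    "nat \<Rightarrow> nat \<Rightarrow> nat \<Rightarrow> int list set \<Rightarrow> nat \<Rightarrow> nat \<Rightarrow> nat \<Rightarrow> (column \<times> nat) list" where
  "extent_reads B b k R p a c =
     concat (map (\<lambda>d. [(Idx (p + d), descend R p d a), (Idx (p + d), descend R p d c)])
       (takeWhile (\<lambda>d. descend R p d c - descend R p d a \<le> b * B) [0..<k - 1 - p]))"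

definition probe_reads ::
    "nat \<Rightarrow> nat \<Rightarrow> nat \<Rightarrow> int list set \<Rightarrow> int list \<Rightarrow> int extended \<Rightarrow> (column \<times> nat) list" where
  "probe_reads B b k R s l =
     (let p = length s;
          a = slice_start R s l;
          fits = (\<lambda>m. occupied_blocks B k (slice R s l (Fin (val R p ! m))) \<le> b);
          (ms, r) = bsearch fits a (search_window B b R s l);
          j = card {u \<in> trie_level R (p - 1). u < s}
      in (if s = [] then [] else [(Idx (p - 1), j), (Idx (p - 1), Suc j)])
         @ concat (map (\<lambda>m. (Val p, m) # extent_reads B b k R p a (Suc m)) ms)
         @ (if r < slice_end R s Pinf then [(Val p, r)] else []))"

text \<open>The words read to locate the upper bound \<open>h\<close> of a slice that fits into \<open>b\<close> blocks.\<close>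

definition locate_reads ::
    "nat \<Rightarrow> nat \<Rightarrow> int list set \<Rightarrow> int list \<Rightarrow> int extended \<Rightarrow> int extended \<Rightarrow> (column \<times> nat) list"
  where
  "locate_reads B b R s l h =
     map (Pair (Val (length s)))
       (fst (bsearch (\<lambda>m. Fin (val R (length s) ! m) \<le> h)
         (slice_start R s l) (search_window B b R s l)))"

text \<open>Blocks holding the given words, each fetched once.  In every array the positions examined by a
  binary search are nested, so buffering the blocks of the two current search limits and of the start
  of the slice suffices for that.\<close>

definition fetched_blocks :: "nat \<Rightarrow> (column \<times> nat) list \<Rightarrow> (column \<times> nat) list" where
  "fetched_blocks B ws = remdups (map (\<lambda>(c, x). (c, x div B)) ws)"

text \<open>The ranges \<open>{x..<y}\<close> of the stored arrays that make up a slice (the values of the prefix \<open>s\<close>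
  are known).\<close>

definition slice_ranges ::
    "nat \<Rightarrow> int list set \<Rightarrow> int list \<Rightarrow> int extended \<Rightarrow> int extended \<Rightarrow> (column \<times> nat \<times> nat) list"
  where
  "slice_ranges k R s l h =
     (let p = length s; a = slice_start R s l; c = slice_end R s h
      in if a < c then
           concat (map (\<lambda>d.
             (Val (p + d), descend R p d a, descend R p d c) #
             (if Suc (p + d) < k then [(Idx (p + d), descend R p d a, Suc (descend R p d c))] else []))
             [0..<k - p])
         else [])"

section \<open>In-memory LFTJ\<close>

text \<open>\<open>P\<close> lists the provisioned slices as pairs of an atom's position in \<open>Q\<close> and a set of tuples;
  \<open>u\<close> is the current binding of the first \<open>length u\<close> variables of \<open>\<pi>\<close>.\<close>

definition lftj_values ::
    "('r, 'v) atom list \<Rightarrow> 'v list \<Rightarrow> (nat \<times> int list set) list \<Rightarrow> int list \<Rightarrow> int set" where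
  "lftj_values Q \<pi> P u =
     (\<Inter>(j, S)\<in>{(j, S) \<in> set P. \<pi> ! length u \<in> set (snd (Q ! j))}.
       {t ! p | t p. t \<in> S \<and> p < length (snd (Q ! j)) \<and> snd (Q ! j) ! p = \<pi> ! length u \<and>
          (\<forall>q<p. map_of (zip \<pi> u) (snd (Q ! j) ! q) = Some (t ! q))})"

fun lftj ::
    "('r, 'v) atom list \<Rightarrow> 'v list \<Rightarrow> (nat \<times> int list set) list \<Rightarrow> nat \<Rightarrow> int list \<Rightarrow> int list list"
  where
  "lftj Q \<pi> P 0 u = [u]"
| "lftj Q \<pi> P (Suc r) u =
     concat (map (\<lambda>v. lftj Q \<pi> P r (u @ [v])) (sorted_list_of_set (lftj_values Q \<pi> P u)))"

section \<open>Boxed LFTJ\<close>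

datatype 'r event =
    Read 'r column nat
  | Output "int list"
  | Spill nat "int list"

text \<open>
  An execution is described by its trace of events.  A pair \<open>(j, s)\<close> in a list \<open>todo\<close> is an atom
  (given by its position in \<open>Q\<close>) that is not yet provisioned, with the prefix \<open>s\<close> of values fixed by
  spills.  It is handled at the dimension of its argument number \<open>length s\<close>, which for \<open>s = []\<close> is the
  dimension of its first variable.  Dimensions are counted from \<open>0\<close>.
\<close>

locale boxed_lftj =
  fixes Q :: "('r, 'v) atom list"
    and \<pi> :: "'v list"
    and ar :: "'r \<Rightarrow> nat"
    and D :: "'r \<Rightarrow> int list set"
    and M :: nat
    and B :: nat
begin

definition symbol :: "nat \<Rightarrow> 'r" where
  "symbol j = fst (Q ! j)"

definition rel :: "nat \<Rightarrow> int list set" where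
  "rel j = D (symbol j)"

text \<open>Apart from the block of the output buffer, four blocks are set aside per stored array of an
  atom: the cached slice boundary and the three blocks buffered by a binary search.\<close>

definition dimension_memory :: nat where
  "dimension_memory = (M - (1 + (\<Sum>(R, xs)\<leftarrow>Q. 4 * (2 * ar R - 1))) * B) div length \<pi>"

definition handled :: "nat \<Rightarrow> (nat \<times> int list) list \<Rightarrow> (nat \<times> int list) list" where
  "handled i todo =
     filter (\<lambda>(j, s). length s < ar (symbol j) \<and> snd (Q ! j) ! length s = \<pi> ! i) todo"

text \<open>In the following, \<open>w\<close> is the memory (in words) of the current dimension \<open>i\<close>.\<close>

definition budget :: "nat \<Rightarrow> (nat \<times> int list) list \<Rightarrow> nat \<Rightarrow> nat" where
  "budget i todo w = w div (length (handled i todo) * B)"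

definition probe_atom ::
    "nat \<Rightarrow> (nat \<times> int list) list \<Rightarrow> nat \<Rightarrow> int extended \<Rightarrow> nat \<times> int list \<Rightarrow> int extended option"
  where
  "probe_atom i todo w low = (\<lambda>(j, s). probe B (budget i todo w) (ar (symbol j)) (rel j) s low)"

definition spilled ::
    "nat \<Rightarrow> (nat \<times> int list) list \<Rightarrow> nat \<Rightarrow> int extended \<Rightarrow> (nat \<times> int list) list" where
  "spilled i todo w low = filter (\<lambda>A. probe_atom i todo w low A = None) (handled i todo)"

definition kept ::
    "nat \<Rightarrow> (nat \<times> int list) list \<Rightarrow> nat \<Rightarrow> int extended \<Rightarrow> (nat \<times> int list) list" where
  "kept i todo w low = filter (\<lambda>A. probe_atom i todo w low A \<noteq> None) (handled i todo)"

definition high :: "nat \<Rightarrow> (nat \<times> int list) list \<Rightarrow> nat \<Rightarrow> int extended \<Rightarrow> int extended" where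
  "high i todo w low =
     (if spilled i todo w low \<noteq> [] then low
      else Min (insert Pinf ((\<lambda>A. the (probe_atom i todo w low A)) ` set (handled i todo))))"

definition provisioned ::
    "nat \<Rightarrow> (nat \<times> int list) list \<Rightarrow> nat \<Rightarrow> int extended \<Rightarrow> (nat \<times> int list set) list" where
  "provisioned i todo w low =
     map (\<lambda>(j, s). (j, slice (rel j) s low (high i todo w low))) (kept i todo w low)"

definition provisioned_words :: "nat \<Rightarrow> (nat \<times> int list) list \<Rightarrow> nat \<Rightarrow> int extended \<Rightarrow> nat" where
  "provisioned_words i todo w low =
     (\<Sum>(j, S)\<leftarrow>provisioned i todo w low. trie_words (ar (symbol j)) S)"

text \<open>The atoms left to later dimensions.  Spilling at \<open>low\<close> requires a value \<open>low\<close> and a next attribute;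
  \<open>can_spill\<close> expresses this.  It fails only if the budget is too small for the trie of a single
  tuple, and it holds trivially when no atom spills.\<close>

definition remaining ::
    "nat \<Rightarrow> (nat \<times> int list) list \<Rightarrow> nat \<Rightarrow> int extended \<Rightarrow> (nat \<times> int list) list" where
  "remaining i todo w low =
     filter (\<lambda>A. A \<notin> set (handled i todo)) todo
     @ map (\<lambda>(j, s). (j, s @ [THE v. low = Fin v])) (spilled i todo w low)"

definition can_spill ::
    "nat \<Rightarrow> (nat \<times> int list) list \<Rightarrow> nat \<Rightarrow> int extended \<Rightarrow> bool" where
  "can_spill i todo w low \<longleftrightarrow>
     (\<forall>(j, s)\<in>set (spilled i todo w low). (\<exists>v. low = Fin v) \<and> Suc (length s) < ar (symbol j))"

definition kept_ranges ::
    "nat \<Rightarrow> (nat \<times> int list) list \<Rightarrow> nat \<Rightarrow> int extended \<Rightarrow> (nat \<times> column \<times> nat \<times> nat) list" where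
  "kept_ranges i todo w low =
     concat (map (\<lambda>(j, s). map (Pair j)
         (slice_ranges (ar (symbol j)) (rel j) s low (high i todo w low)))
       (kept i todo w low))"

definition probe_events ::
    "nat \<Rightarrow> (nat \<times> int list) list \<Rightarrow> nat \<Rightarrow> int extended \<Rightarrow> 'r event list" where
  "probe_events i todo w low =
     concat (map (\<lambda>(j, s). map (\<lambda>(c, x). Read (symbol j) c x)
         (fetched_blocks B (probe_reads B (budget i todo w) (ar (symbol j)) (rel j) s low)))
       (handled i todo))
     @ map (\<lambda>(j, s). Spill j s) (spilled i todo w low)"

text \<open>A cache records, for each array of each atom, the last block read for the preceding slice of the
  same pass.\<close>

definition provision_events ::
    "nat \<Rightarrow> (nat \<times> int list) list \<Rightarrow> nat \<Rightarrow> int extended \<Rightarrow> (nat \<times> column \<rightharpoonup> nat) \<Rightarrow> 'r event list"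
  where
  "provision_events i todo w low cache =
     concat (map (\<lambda>(j, s). map (\<lambda>(c, x). Read (symbol j) c x)
         (fetched_blocks B (locate_reads B (budget i todo w) (rel j) s low (high i todo w low))))
       (kept i todo w low))
     @ concat (map (\<lambda>(j, c, x, y). map (Read (symbol j) c)
         (filter (\<lambda>z. cache (j, c) \<noteq> Some z) [x div B..<Suc ((y - 1) div B)]))
       (kept_ranges i todo w low))"

definition new_cache ::
    "nat \<Rightarrow> (nat \<times> int list) list \<Rightarrow> nat \<Rightarrow> int extended \<Rightarrow> (nat \<times> column \<rightharpoonup> nat) \<Rightarrow>
     (nat \<times> column \<rightharpoonup> nat)" where
  "new_cache i todo w low cache =
     cache ++ map_of (map (\<lambda>(j, c, x, y). ((j, c), (y - 1) div B)) (kept_ranges i todo w low))"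

text \<open>
  \<open>box_up i todo P w tr\<close>: a call of BoxUp for dimension \<open>i\<close>, with slices \<open>P\<close> provisioned so far, has
  trace \<open>tr\<close>; a call for dimension \<open>length \<pi>\<close> is the run of in-memory LFTJ on the current box.
  \<open>box_loop i todo P w low cache tr\<close>: the iterations from lower bound \<open>low\<close> onwards have trace \<open>tr\<close>.
  The amount \<open>e\<close> of unused memory that is passed on to the next dimension is arbitrary.
\<close>

inductive box_up ::
    "nat \<Rightarrow> (nat \<times> int list) list \<Rightarrow> (nat \<times> int list set) list \<Rightarrow> nat \<Rightarrow> 'r event list \<Rightarrow> bool"
  and box_loop ::
    "nat \<Rightarrow> (nat \<times> int list) list \<Rightarrow> (nat \<times> int list set) list \<Rightarrow> nat \<Rightarrow>
     int extended \<Rightarrow> (nat \<times> column \<rightharpoonup> nat) \<Rightarrow> 'r event list \<Rightarrow> bool"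
where
  join: "box_up (length \<pi>) todo P w (map Output (lftj Q \<pi> P (length \<pi>) []))"
| pass: "\<lbrakk>i < length \<pi>; box_loop i todo P w Minf Map.empty tr\<rbrakk> \<Longrightarrow> box_up i todo P w tr"
| last: "\<lbrakk>can_spill i todo w low;
     e \<le> w - provisioned_words i todo w low;
     box_up (Suc i) (remaining i todo w low) (P @ provisioned i todo w low)
       (dimension_memory + e) tr;
     high i todo w low = Pinf\<rbrakk>
   \<Longrightarrow> box_loop i todo P w low cache
     (probe_events i todo w low @ provision_events i todo w low cache @ tr)"
| iterate: "\<lbrakk>can_spill i todo w low;
     e \<le> w - provisioned_words i todo w low;
     box_up (Suc i) (remaining i todo w low) (P @ provisioned i todo w low)
       (dimension_memory + e) tr;
     high i todo w low = Fin h;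
     box_loop i todo P w (Fin (h + 1)) (new_cache i todo w low cache) tr'\<rbrakk>
   \<Longrightarrow> box_loop i todo P w low cache
     (probe_events i todo w low @ provision_events i todo w low cache @ tr @ tr')"

definition execution :: "'r event list \<Rightarrow> bool" where
  "execution tr \<longleftrightarrow> box_up 0 (map (\<lambda>j. (j, [])) [0..<length Q]) [] dimension_memory tr"

end

definition spill_free :: "'r event list \<Rightarrow> bool" where
  "spill_free tr \<longleftrightarrow> (\<forall>j s. Spill j s \<notin> set tr)"

text \<open>Output tuples of \<open>n\<close> words are appended to a buffer of one block, which is written when it is full
  and at the end.\<close>

definition io_cost :: "nat \<Rightarrow> nat \<Rightarrow> 'r event list \<Rightarrow> nat" where
  "io_cost n B tr =
     length (filter (\<lambda>e. \<exists>R c x. e = Read R c x) tr)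
     + nat \<lceil>real (n * length (filter (\<lambda>e. \<exists>u. e = Output u) tr)) / real B\<rceil>"

end

theory Submission
  imports Defs
begin

text \<open>
  Without spills, the budget of every atom is a constant fraction of \<open>M / B\<close> blocks, unless it is
  \<open>0\<close>, and then a pass has a single iteration.  If an iteration ends at a finite value \<open>h\<close>, then some
  atom's slice extended to \<open>h + 1\<close> exceeds its budget.  Hence any two consecutive iterations of a pass
  consume a constant fraction of \<open>M\<close> words of some relation, and a pass has \<open>O(|I| / M)\<close> iterations.
  Every word read in one iteration lies, for each stored array, in a window of the size of the
  budget, so one iteration reads \<open>O(M / B)\<close> blocks.  Only the first \<open>\<ell>\<close> dimensions can have atoms, where
  \<open>\<ell>\<close> is the rank, and the other dimensions read nothing; nesting the passes gives
  \<open>O((|I| / M)^\<ell> M / B)\<close> reads.  The boxes are disjoint, so every answer is written at most once.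
\<close>

section \<open>Sizes of tries and slices\<close>

text \<open>Progress cannot be measured in words: each slice carries its own sentinels at the ends
  of its index arrays, so disjoint slices may together have more words than the relation.
  \<open>trie_nodes\<close> leaves the sentinels out. It is superadditive on sets of tuples with
  different first values, and on a nonempty slice it is at least half of the words. The slice that
  exceeds the budget ends with the value \<open>h + 1\<close>, which is provisioned only in the next
  iteration and may alone cause the excess, so one slice by itself can be arbitrarily small. The
  atom that determines \<open>h\<close> may change from one iteration to the next; hence the
  potential \<open>nodes_left\<close> adds up all atoms of the dimension, of which one drops enough
  and the others never increase. Since nothing spills, every prefix is \<open>[]\<close>, and the
  atoms handled at a dimension do not depend on how the recursion reached it.\<close>

definition trie_nodes :: "nat \<Rightarrow> int list set \<Rightarrow> nat" where
  "trie_nodes k R = (\<Sum>i<k. card (trie_level R i)) + (\<Sum>i<k - 1. card (trie_level R i))"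

lemma finite_trie_level [simp]: "finite R \<Longrightarrow> finite (trie_level R i)"
  by (simp add: trie_level_def)

lemma trie_level_mono: "R \<subseteq> S \<Longrightarrow> trie_level R i \<subseteq> trie_level S i"
  by (auto simp: trie_level_def)

lemma length_val [simp]: "length (val R i) = card (trie_level R i)"
  by (simp add: val_def)

lemma length_idx [simp]: "length (idx R i) = Suc (card (trie_level R i))"
  by (simp add: idx_def)

lemma trie_words_eq: "trie_words k R = trie_nodes k R + (k - 1)"
  by (simp add: trie_words_def trie_nodes_def sum_Suc)

lemma trie_nodes_mono:
  assumes "R \<subseteq> S" "finite S"
  shows "trie_nodes k R \<le> trie_nodes k S"
  unfolding trie_nodes_def
  using assms by (intro add_mono sum_mono card_mono finite_trie_level trie_level_mono)

lemma trie_words_mono: "R \<subseteq> S \<Longrightarrow> finite S \<Longrightarrow> trie_words k R \<le> trie_words k S"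
  by (simp add: trie_words_eq trie_nodes_mono)

text \<open>A node contains the first value of its tuples, so tuples with different first values
  share no node in any column. For \<open>trie_words\<close> this would fail, because the sentinels
  would be counted twice on the left.\<close>

lemma trie_nodes_disjoint:
  assumes "R \<subseteq> T" "S \<subseteq> T" "finite T"
    and disj: "\<And>r s. r \<in> R \<Longrightarrow> s \<in> S \<Longrightarrow> r ! 0 \<noteq> s ! 0"
  shows "trie_nodes k R + trie_nodes k S \<le> trie_nodes k T"
proof -
  have *: "card (trie_level R i) + card (trie_level S i) \<le> card (trie_level T i)" for i
  proof -
    have "trie_level R i \<inter> trie_level S i = {}"
    proof (rule ccontr)
      assume "trie_level R i \<inter> trie_level S i \<noteq> {}"
      then obtain r s where "r \<in> R" "s \<in> S" and eq: "take (Suc i) r = take (Suc i) s"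
        by (auto simp: trie_level_def)
      moreover have "r ! 0 = s ! 0"
        using arg_cong[OF eq, of "\<lambda>u. u ! 0"] by simp
      ultimately show False using disj by blast
    qed
    moreover have "finite R" "finite S"
      using assms finite_subset by blast+
    ultimately have "card (trie_level R i) + card (trie_level S i) =
        card (trie_level R i \<union> trie_level S i)"
      by (simp add: card_Un_disjoint)
    also have "\<dots> \<le> card (trie_level T i)"
      using assms by (intro card_mono) (simp_all add: trie_level_mono)
    finally show ?thesis .
  qed
  have "(\<Sum>i<n. card (trie_level R i)) + (\<Sum>i<n. card (trie_level S i)) \<le>
      (\<Sum>i<n. card (trie_level T i))" for n
    unfolding sum.distrib[symmetric] by (intro sum_mono *)
  from this[of k] this[of "k - 1"] show ?thesis
    by (simp add: trie_nodes_def)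
qed

text \<open>A nonempty trie has a node in every column. This absorbs the \<open>k - 1\<close>
  sentinels into the node count, and for \<open>0 < k\<close> it shows that a slice of zero words is
  empty.\<close>

lemma arity_le_trie_nodes:
  assumes "R \<noteq> {}" "finite R"
  shows "k \<le> trie_nodes k R"
proof -
  have "1 \<le> card (trie_level R i)" for i
    using assms by (simp add: Suc_le_eq card_gt_0_iff trie_level_def)
  then have "(\<Sum>i<k. 1) \<le> (\<Sum>i<k. card (trie_level R i))"
    by (intro sum_mono)
  then show ?thesis by (simp add: trie_nodes_def)
qed

lemma occupied_blocks_le_iff:
  assumes "0 < B"
  shows "occupied_blocks B k R \<le> b \<longleftrightarrow> trie_words k R \<le> b * B"
proof -
  have "occupied_blocks B k R \<le> b \<longleftrightarrow> real (trie_words k R) / real B \<le> real b"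
    by (simp add: occupied_blocks_def nat_le_iff ceiling_le_iff)
  also have "\<dots> \<longleftrightarrow> real (trie_words k R) \<le> real (b * B)"
    using assms by (simp add: pos_divide_le_eq)
  finally show ?thesis by linarith
qed

lemma slice_Nil: "slice R [] l h = {t \<in> R. l \<le> Fin (t ! 0) \<and> Fin (t ! 0) \<le> h}"
  by (auto simp: slice_def)

lemma slice_subset: "slice R s l h \<subseteq> R"
  by (auto simp: slice_def)

lemma slice_mono: "h \<le> h' \<Longrightarrow> slice R s l h \<subseteq> slice R s l h'"
  by (auto simp: slice_def)

text \<open>\<open>GREATEST\<close> is meaningful only if a largest fitting bound exists, and the
  bounds form an infinite order. Finiteness of \<open>R\<close> supplies it: from the largest stored
  value on, every bound gives the same slice as \<open>Pinf\<close>.\<close>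

lemma probe_SomeD:
  assumes "finite R" "0 < B" "probe B b k R s l = Some g"
  shows "l \<le> g" and "trie_words k (slice R s l g) \<le> b * B"
    and "\<And>h. g < h \<Longrightarrow> b * B < trie_words k (slice R s l h)"
proof -
  define fits where "fits h \<longleftrightarrow> l \<le> h \<and> trie_words k (slice R s l h) \<le> b * B" for h
  have probe: "probe B b k R s l = (if \<exists>h. fits h then Some (GREATEST h. fits h) else None)"
    unfolding probe_def fits_def occupied_blocks_le_iff[OF \<open>0 < B\<close>] Let_def ..
  with assms(3) obtain h0 where "fits h0" and g: "g = (GREATEST h. fits h)"
    by (auto split: if_splits)
  have "\<exists>m. fits m \<and> (\<forall>h. fits h \<longrightarrow> h \<le> m)"
  proof (cases "fits Pinf")
    case True
    then show ?thesis by (intro exI[of _ Pinf]) simp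
  next
    case not_inf: False
    \<comment> \<open>The element \<open>0\<close> makes \<open>Max\<close> well defined for empty
      \<open>R\<close>. A fitting finite bound lies below \<open>V\<close>, since otherwise
      \<open>Pinf\<close> would fit as well.\<close>
    define V where "V = Max (insert 0 ((\<lambda>t. t ! length s) ` R))"
    have V: "v < V" if "fits (Fin v)" for v
    proof (rule ccontr)
      assume "\<not> v < V"
      have "t ! length s \<le> v" if "t \<in> R" for t
      proof -
        have "t ! length s \<le> V"
          unfolding V_def using that \<open>finite R\<close> by (intro Max_ge) auto
        with \<open>\<not> v < V\<close> show ?thesis by simp
      qed
      then have "slice R s l (Fin v) = slice R s l Pinf"
        by (auto simp: slice_def)
      with that not_inf show False by (simp add: fits_def less_eq_extended.simps)
    qed
    show ?thesis
    proof (cases "\<exists>v. fits (Fin v)")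
      case True
      then obtain v0 where v0: "fits (Fin v0)" ..
      define W where "W = {v. v0 \<le> v \<and> fits (Fin v)}"
      have "W \<subseteq> {v0..V}" using V by (auto simp: W_def less_imp_le)
      then have "finite W" by (rule finite_subset) simp
      moreover have "v0 \<in> W" using v0 by (simp add: W_def)
      ultimately have max: "Max W \<in> W" "\<And>v. v \<in> W \<Longrightarrow> v \<le> Max W"
        by (auto intro: Max_in)
      have "h \<le> Fin (Max W)" if "fits h" for h
      proof (cases h)
        case (Fin v)
        then show ?thesis
          using max \<open>v0 \<in> W\<close> that by (cases "v0 \<le> v") (force simp: W_def)+
      qed (use that not_inf in auto)
      with max(1) show ?thesis by (auto simp: W_def)
    next
      case False
      have "h = Minf" if "fits h" for h
        using that False not_inf by (cases h) auto
      with \<open>fits h0\<close> show ?thesis by blast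
    qed
  qed
  then obtain m where m: "fits m" "\<And>h. fits h \<Longrightarrow> h \<le> m" by blast
  then have "g = m" unfolding g by (intro Greatest_equality)
  with m show "l \<le> g" "trie_words k (slice R s l g) \<le> b * B"
    by (auto simp: fits_def)
  show "b * B < trie_words k (slice R s l h)" if "g < h" for h
  proof (rule ccontr)
    assume "\<not> ?thesis"
    with \<open>l \<le> g\<close> that have "fits h" by (auto simp: fits_def)
    with m \<open>g = m\<close> that show False by fastforce
  qed
qed

section \<open>Positions in the stored arrays\<close>

lemma sorted_list_of_set_nth_less_iff:
  fixes X :: "'a::linorder set"
  assumes "finite X" "i < card X" "v \<in> X"
  shows "v < sorted_list_of_set X ! i \<longleftrightarrow> v \<in> set (take i (sorted_list_of_set X))"
proof -
  let ?xs = "sorted_list_of_set X"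
  have len: "length ?xs = card X" by simp
  obtain j where j: "j < card X" "?xs ! j = v"
    using assms by (metis in_set_conv_nth len set_sorted_list_of_set)
  have sorted: "sorted_wrt (<) ?xs" by (rule strict_sorted_list_of_set)
  have less: "?xs ! p < ?xs ! q \<longleftrightarrow> p < q" if "p < card X" "q < card X" for p q
    using sorted that by (metis len linorder_neqE_nat order_less_asym order_less_irrefl sorted_wrt_iff_nth_less)
  have "v \<in> set (take i ?xs) \<longleftrightarrow> j < i"
    using j assms(2) less by (auto simp: in_set_conv_nth)
      (metis nth_eq_iff_index_eq distinct_sorted_list_of_set len order.strict_trans)
  then show ?thesis using less[of j i] j assms by simp
qed

text \<open>\<open>y\<close> may be the sentinel position, where slices reaching the end of a column
  stop; its entry is the size of the whole next column.\<close>

lemma idx_mono: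
  assumes "finite R" "x \<le> y" "y \<le> card (trie_level R i)"
  shows "idx R i ! x \<le> idx R i ! y"
proof -
  let ?X = "trie_level R i" and ?Y = "trie_level R (Suc i)"
  have fin: "finite {w \<in> ?Y. take (Suc i) w < u}" for u using assms by simp
  consider "x = y" | "x < y" "y = card ?X" | "x < y" "y < card ?X" using assms by linarith
  then show ?thesis
  proof cases
    case 2
    then show ?thesis using assms
      by (auto simp: idx_def nth_append intro: card_mono)
  next
    case 3
    then have "sorted_list_of_set ?X ! x < sorted_list_of_set ?X ! y"
      using strict_sorted_list_of_set[of ?X] by (simp add: sorted_wrt_iff_nth_less)
    then have "{w \<in> ?Y. take (Suc i) w < sorted_list_of_set ?X ! x} \<subseteq>
        {w \<in> ?Y. take (Suc i) w < sorted_list_of_set ?X ! y}"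
      by auto
    with 3 fin show ?thesis by (auto simp: idx_def nth_append intro: card_mono)
  qed simp
qed

lemma idx_le:
  assumes "finite R" "x \<le> card (trie_level R i)"
  shows "idx R i ! x \<le> card (trie_level R (Suc i))"
  using idx_mono[OF assms(1) assms(2) order_refl] by (simp add: idx_def nth_append)

lemma descend_le:
  assumes "finite R" "x \<le> card (trie_level R p)"
  shows "descend R p d x \<le> card (trie_level R (p + d))"
  using assms by (induction d) (use idx_le in auto)

lemma descend_mono:
  assumes "finite R" "x \<le> y" "y \<le> card (trie_level R p)"
  shows "descend R p d x \<le> descend R p d y"
  using assms by (induction d) (auto intro!: idx_mono descend_le)

text \<open>This turns pointer chasing into counting. The lexicographic order compares first values
  first, so a downward closed condition on the first value cuts off an initial segment of every
  column, and the index entry at the end of a segment counts the children of that segment.\<close>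

lemma descend_initial:
  assumes "finite R" and ne: "\<And>t. t \<in> R \<Longrightarrow> t \<noteq> []"
    and down: "\<And>v w::int. v \<le> w \<Longrightarrow> c w \<Longrightarrow> c v"
  shows "descend R 0 d (card {u \<in> trie_level R 0. c (u ! 0)}) = card {u \<in> trie_level R d. c (u ! 0)}"
proof (induction d)
  case (Suc d)
  let ?X = "trie_level R d" and ?Y = "trie_level R (Suc d)"
  let ?xs = "sorted_list_of_set ?X"
  define x where "x = card {u \<in> ?X. c (u ! 0)}"
  have fin: "finite ?X" using \<open>finite R\<close> by simp
  have ne': "u \<noteq> []" if "u \<in> ?X" for u using that ne by (auto simp: trie_level_def)
  have prefix: "take (Suc d) w \<in> ?X" if "w \<in> ?Y" for w
    using that by (auto simp: trie_level_def min_def)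
  have downX: "c (v ! 0)" if "v \<le> u" "c (u ! 0)" "v \<in> ?X" "u \<in> ?X" for u v
  proof -
    have "v ! 0 \<le> u ! 0"
      using that ne'[of u] ne'[of v] by (cases u; cases v) (auto simp: Cons_le_Cons)
    with that(2) show ?thesis using down by blast
  qed
  have "x \<le> card ?X" unfolding x_def using fin by (intro card_mono) auto
  have "idx R d ! x = card {w \<in> ?Y. c (w ! 0)}"
  \<comment> \<open>If every node is selected, position \<open>x\<close> is that of the
    sentinel.\<close>
  proof (cases "x = card ?X")
    case True
    then have "{u \<in> ?X. c (u ! 0)} = ?X"
      using fin by (intro card_subset_eq) (auto simp: x_def)
    then have "c (w ! 0)" if "w \<in> ?Y" for w
    proof -
      have "take (Suc d) w \<in> {u \<in> ?X. c (u ! 0)}"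
        using prefix[OF that] \<open>{u \<in> ?X. c (u ! 0)} = ?X\<close> by argo
      then show ?thesis by simp
    qed
    then have "{w \<in> ?Y. c (w ! 0)} = ?Y" by blast
    with True show ?thesis by (simp add: idx_def nth_append)
  next
    case False
    with \<open>x \<le> card ?X\<close> have "x < card ?X" by simp
    \<comment> \<open>\<open>u\<close> is the first node violating \<open>c\<close>. The selected
      nodes are then exactly those below \<open>u\<close>, which is the comparison by which
      \<open>idx\<close> counts.\<close>
    define u where "u = ?xs ! x"
    have "u \<in> ?X" unfolding u_def using \<open>x < card ?X\<close> fin
      by (metis length_sorted_list_of_set nth_mem set_sorted_list_of_set)
    have card_less: "card {v \<in> ?X. v < u} = x"
    proof -
      have "v < u \<longleftrightarrow> v \<in> set (take x ?xs)" if "v \<in> ?X" for v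
        unfolding u_def by (rule sorted_list_of_set_nth_less_iff[OF fin \<open>x < card ?X\<close> that])
      moreover have "set (take x ?xs) \<subseteq> ?X"
        using set_take_subset[of x ?xs] fin by simp
      ultimately have "{v \<in> ?X. v < u} = set (take x ?xs)"
        by blast
      then show ?thesis using \<open>x < card ?X\<close>
        by (simp add: distinct_card)
    qed
    have not_c: "\<not> c (u ! 0)"
    proof
      assume "c (u ! 0)"
      then have "insert u {v \<in> ?X. v < u} \<subseteq> {v \<in> ?X. c (v ! 0)}"
        using downX[OF less_imp_le _ _ \<open>u \<in> ?X\<close>] \<open>u \<in> ?X\<close> by blast
      from card_mono[OF _ this] fin card_less show False by (simp add: x_def)
    qed
    have "{v \<in> ?X. c (v ! 0)} \<subseteq> {v \<in> ?X. v < u}"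
      using downX[OF _ _ \<open>u \<in> ?X\<close>] not_c by (fastforce simp: not_less[symmetric])
    from card_subset_eq[OF _ this] fin card_less
    have eq: "{v \<in> ?X. c (v ! 0)} = {v \<in> ?X. v < u}" by (simp add: x_def)
    have "take (Suc d) w < u \<longleftrightarrow> c (w ! 0)" if "w \<in> ?Y" for w
    proof -
      have "take (Suc d) w \<in> {v \<in> ?X. v < u} \<longleftrightarrow> take (Suc d) w \<in> {v \<in> ?X. c (v ! 0)}"
        by (simp only: eq)
      then show ?thesis using prefix[OF that] by simp
    qed
    then have "{w \<in> ?Y. take (Suc d) w < u} = {w \<in> ?Y. c (w ! 0)}" by blast
    with \<open>x < card ?X\<close> show ?thesis by (simp add: idx_def nth_append u_def)
  qed
  with Suc show ?case by (simp add: x_def)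
qed simp

lemma nth_0_eq_last_trie_level: "\<lbrakk>u \<in> trie_level R 0; \<And>t. t \<in> R \<Longrightarrow> t \<noteq> []\<rbrakk> \<Longrightarrow> last u = u ! 0"
  by (auto simp: trie_level_def last_conv_nth take_Suc)

text \<open>Both ends of the range are sizes of initial segments of column \<open>d\<close> by
  \<open>descend_initial\<close>, and a node in their difference is a prefix of a tuple of the
  slice.\<close>

lemma slice_range_length:
  assumes "finite R" and ne: "\<And>t. t \<in> R \<Longrightarrow> t \<noteq> []"
  shows "descend R 0 d (slice_end R [] h) - descend R 0 d (slice_start R [] l)
    \<le> card (trie_level (slice R [] l h) d)"
proof -
  let ?X = "trie_level R d"
  have start: "slice_start R [] l = card {u \<in> trie_level R 0. Fin (u ! 0) < l}"
    unfolding slice_start_def using nth_0_eq_last_trie_level[OF _ ne]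
    by (intro arg_cong[where f = card]) auto
  have "end": "slice_end R [] h = card {u \<in> trie_level R 0. Fin (u ! 0) \<le> h}"
    unfolding slice_end_def using nth_0_eq_last_trie_level[OF _ ne]
    by (intro arg_cong[where f = card]) auto
  have s: "descend R 0 d (slice_start R [] l) = card {u \<in> ?X. Fin (u ! 0) < l}"
    unfolding start by (rule descend_initial[OF assms]) (auto elim: order.strict_trans1[rotated])
  have e: "descend R 0 d (slice_end R [] h) = card {u \<in> ?X. Fin (u ! 0) \<le> h}"
    unfolding "end" by (rule descend_initial[OF assms]) (auto elim: order.trans[rotated])
  have "card {u \<in> ?X. Fin (u ! 0) \<le> h} - card {u \<in> ?X. Fin (u ! 0) < l} \<le>
      card ({u \<in> ?X. Fin (u ! 0) \<le> h} - {u \<in> ?X. Fin (u ! 0) < l})"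
    by (rule diff_card_le_card_Diff) (use assms in simp)
  also have "\<dots> \<le> card (trie_level (slice R [] l h) d)"
    using assms finite_subset[OF slice_subset]
    by (intro card_mono) (auto simp: trie_level_def slice_Nil)
  finally show ?thesis unfolding s e .
qed

text \<open>Costs count distinct blocks, so the window that contains the examined positions is what
  matters. \<open>max lo hi\<close> covers the empty window, where the result is
  \<open>lo\<close>.\<close>

lemma bsearch_bounds:
  "bsearch P lo hi = (ms, r) \<Longrightarrow> set ms \<subseteq> {lo..<hi} \<and> lo \<le> r \<and> r \<le> max lo hi"
proof (induction P lo hi arbitrary: ms r rule: bsearch.induct)
  case (1 P lo hi)
  show ?case
  proof (cases "lo < hi")
    case True
    define m where "m = (lo + hi) div 2"
    have m: "lo \<le> m" "m < hi" using True by (auto simp: m_def)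
    obtain ms' r' where rec:
      "(if P m then bsearch P (Suc m) hi else bsearch P lo m) = (ms', r')"
      by fastforce
    have "ms = m # ms'" "r = r'"
      using 1(3) True rec unfolding bsearch.simps[of P lo hi] m_def[symmetric] Let_def by simp_all
    moreover have "set ms' \<subseteq> {lo..<hi} \<and> lo \<le> r' \<and> r' \<le> max lo hi"
    proof (cases "P m")
      case Pm: True
      with rec have "bsearch P (Suc m) hi = (ms', r')" by simp
      from 1(1)[OF True m_def Pm this] m show ?thesis by force
    next
      case Pm: False
      with rec have "bsearch P lo m = (ms', r')" by simp
      from 1(2)[OF True m_def Pm this] m show ?thesis by force
    qed
    ultimately show ?thesis using m by auto
  next
    case False
    with 1(3) show ?thesis by (auto simp: bsearch.simps[of P lo hi])
  qed
qed

section \<open>Blocks read by a probe and by provisioning\<close>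

text \<open>\<open>X\<close> is the set of touched arrays and \<open>f\<close> gives an anchor
  position in each. A stretch of \<open>b * B\<close> words beyond the anchor meets at most
  \<open>b + 1\<close> blocks, and no block is fetched twice.\<close>

lemma length_fetched_blocks_le:
  assumes "finite X" "0 < B"
    and near: "\<And>c x. (c, x) \<in> set ws \<Longrightarrow> c \<in> X \<and> f c \<le> x \<and> x \<le> f c + b * B"
  shows "length (fetched_blocks B ws) \<le> card X * Suc b"
proof -
  have "set (fetched_blocks B ws) \<subseteq> Sigma X (\<lambda>c. {f c div B..f c div B + b})"
  proof (clarsimp simp: fetched_blocks_def)
    fix c x assume "(c, x) \<in> set ws"
    from near[OF this] have "c \<in> X" "f c div B \<le> x div B" "x div B \<le> (f c + b * B) div B"
      by (auto intro: div_le_mono)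
    then show "c \<in> X \<and> f c div B \<le> x div B \<and> x div B \<le> f c div B + b"
      using \<open>0 < B\<close> by simp
  qed
  then have "card (set (fetched_blocks B ws)) \<le> card (Sigma X (\<lambda>c. {f c div B..f c div B + b}))"
    by (intro card_mono) (use assms in auto)
  also have "\<dots> = card X * Suc b" using assms by (simp add: card_SigmaI)
  also have "card (set (fetched_blocks B ws)) = length (fetched_blocks B ws)"
    by (intro distinct_card) (simp add: fetched_blocks_def)
  finally show ?thesis .
qed

lemma extent_reads_near:
  assumes "finite R" "x \<le> y" "y \<le> card (trie_level R p)" "(c, z) \<in> set (extent_reads B b k R p x y)"
  shows "\<exists>d<k - 1 - p. c = Idx (p + d) \<and> descend R p d x \<le> z \<and> z \<le> descend R p d x + b * B"
proof -
  from assms(4) obtain d where "d \<in> set (takeWhile (\<lambda>d. descend R p d y - descend R p d x \<le> b * B) [0..<k - 1 - p])"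
    and "c = Idx (p + d)" "z = descend R p d x \<or> z = descend R p d y"
    by (auto simp: extent_reads_def)
  then show ?thesis
    \<comment> \<open>The guard of \<open>takeWhile\<close> keeps the second position close from
      above; monotonicity keeps it from lying before the anchor.\<close>
    using descend_mono[OF assms(1-3), of d] by (force dest: set_takeWhileD)
qed

lemma slice_end_le: "finite R \<Longrightarrow> slice_end R s h \<le> card (trie_level R (length s))"
  unfolding slice_end_def by (intro card_mono) auto

lemma length_fetched_probe_reads:
  assumes "finite R" "0 < B" "0 < k"
  shows "length (fetched_blocks B (probe_reads B b k R [] l)) \<le> k * Suc b"
proof -
  define a where "a = slice_start R [] l"
  let ?win = "search_window B b R [] l"
  obtain ms r where bs: "bsearch (\<lambda>m. occupied_blocks B k (slice R [] l (Fin (val R 0 ! m))) \<le> b) a ?win = (ms, r)"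
    by fastforce
  have reads: "probe_reads B b k R [] l =
      concat (map (\<lambda>m. (Val 0, m) # extent_reads B b k R 0 a (Suc m)) ms)
      @ (if r < slice_end R [] Pinf then [(Val 0, r)] else [])"
    using bs by (simp add: probe_reads_def Let_def a_def)
  note bounds = bsearch_bounds[OF bs]
  \<comment> \<open>A probe touches one value array and \<open>k - 1\<close> index arrays, hence
    \<open>k\<close> arrays; each is anchored where the descendants of the slice start
    begin.\<close>
  let ?X = "insert (Val 0) (Idx ` {..<k - 1})"
  let ?f = "\<lambda>c. case c of Val _ \<Rightarrow> a | Idx d \<Rightarrow> descend R 0 d a"
  have "length (fetched_blocks B (probe_reads B b k R [] l)) \<le> card ?X * Suc b"
  proof (rule length_fetched_blocks_le[where f = ?f])
    fix c x assume "(c, x) \<in> set (probe_reads B b k R [] l)"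
    then consider "c = Val 0" "x \<in> set ms \<or> x = r"
      | m where "m \<in> set ms" "(c, x) \<in> set (extent_reads B b k R 0 a (Suc m))"
      by (auto simp: reads split: if_splits)
    then show "c \<in> ?X \<and> ?f c \<le> x \<and> x \<le> ?f c + b * B"
    proof cases
      case 1
      with bounds show ?thesis
        by (fastforce simp: search_window_def a_def max_def split: if_splits)
    next
      case 2
      with bounds have "a \<le> m" "m < slice_end R [] Pinf" by (auto simp: search_window_def)
      with slice_end_le[OF \<open>finite R\<close>, of "[]" Pinf] have "a \<le> Suc m" "Suc m \<le> card (trie_level R 0)"
        by auto
      from extent_reads_near[OF \<open>finite R\<close> this 2(2)] show ?thesis by auto
    qed
  qed (use assms in auto)
  also have "card ?X = k"
    using \<open>0 < k\<close> by (subst card_insert_disjoint) (auto simp: card_image inj_on_def)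
  finally show ?thesis .
qed

lemma length_fetched_locate_reads:
  assumes "0 < B"
  shows "length (fetched_blocks B (locate_reads B b R [] l h)) \<le> Suc b"
proof -
  obtain ms r where bs: "bsearch (\<lambda>m. Fin (val R 0 ! m) \<le> h)
      (slice_start R [] l) (search_window B b R [] l) = (ms, r)"
    by fastforce
  have "length (fetched_blocks B (locate_reads B b R [] l h)) \<le> card {Val 0} * Suc b"
    by (rule length_fetched_blocks_le[where f = "\<lambda>_. slice_start R [] l"])
      (use assms bs bsearch_bounds[OF bs] in \<open>auto simp: locate_reads_def search_window_def\<close>)
  then show ?thesis by simp
qed

lemma length_slice_ranges: "length (slice_ranges k R s l h) \<le> 2 * (k - length s)"
proof -
  have "length (concat (map (\<lambda>d. X d # (if P d then [Y d] else [])) ds)) \<le> 2 * length ds"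
    for X Y :: "nat \<Rightarrow> column \<times> nat \<times> nat" and P ds
    by (induction ds) auto
  from this[of _ _ _ "[0..<k - length s]"] show ?thesis
    by (simp add: slice_ranges_def Let_def)
qed

lemma slice_ranges_bound:
  assumes "finite R" and ne: "\<And>t. t \<in> R \<Longrightarrow> t \<noteq> []"
    and "(c, x, y) \<in> set (slice_ranges k R [] l h)"
  shows "y - x \<le> trie_words k (slice R [] l h)"
proof -
  let ?S = "slice R [] l h"
  let ?x = "\<lambda>d. descend R 0 d (slice_start R [] l)" and ?y = "\<lambda>d. descend R 0 d (slice_end R [] h)"
  from assms(3) obtain d where d: "d < k"
    and cxy: "(c, x, y) \<in> set ((Val d, ?x d, ?y d) # (if Suc d < k then [(Idx d, ?x d, Suc (?y d))] else []))"
    by (force simp: slice_ranges_def Let_def simp del: set_simps split: if_splits(2))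
  from cxy have xy: "x = ?x d" "y = ?y d \<or> Suc d < k \<and> y = Suc (?y d)"
    by (auto split: if_splits)
  note len = slice_range_length[OF assms(1,2), of d h l]
  have le: "f d \<le> sum f {..<n}" if "d < n" for f :: "nat \<Rightarrow> nat" and n
    using that by (intro member_le_sum) auto
  from xy(2) show ?thesis
  proof
    assume "y = descend R 0 d (slice_end R [] h)"
    then have "y - x \<le> length (val ?S d)" using len xy by simp
    also have "\<dots> \<le> trie_words k ?S"
      using le[OF d, of "\<lambda>i. length (val ?S i)"] unfolding trie_words_def by linarith
    finally show ?thesis .
  next
    \<comment> \<open>The copied index range has one entry more than there are nodes, the end of the
      last child range; it matches the sentinel of the slice's own index array.\<close>
    assume y: "Suc d < k \<and> y = Suc (descend R 0 d (slice_end R [] h))"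
    then have "y - x \<le> length (idx ?S d)" using len xy by simp
    also have "\<dots> \<le> trie_words k ?S"
      using le[of "k - 1" "\<lambda>i. length (idx ?S i)"] y unfolding trie_words_def by linarith
    finally show ?thesis .
  qed
qed

section \<open>Soundness of in-memory LFTJ\<close>

text \<open>The written blocks only have to be bounded from above, so soundness and distinctness
  suffice. Keeping the membership for every depth allows a single depth to be singled out
  later.\<close>

lemma lftj_sound:
  assumes "x \<in> set (lftj Q \<pi> P r u)"
  shows "length x = length u + r \<and> take (length u) x = u \<and>
    (\<forall>p. length u \<le> p \<and> p < length x \<longrightarrow> x ! p \<in> lftj_values Q \<pi> P (take p x))"
  using assms
proof (induction r arbitrary: u)
  case (Suc r)
  then obtain v where v: "v \<in> set (sorted_list_of_set (lftj_values Q \<pi> P u))"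
    and x: "x \<in> set (lftj Q \<pi> P r (u @ [v]))"
    by auto
  \<comment> \<open>An intersection over no atoms is \<open>UNIV\<close>; on an infinite set
    \<open>sorted_list_of_set\<close> yields \<open>[]\<close>, so \<open>v\<close> cannot come from
    one.\<close>
  from v have v': "v \<in> lftj_values Q \<pi> P u"
    by (cases "finite (lftj_values Q \<pi> P u)") simp_all
  from Suc.IH[OF x] have len: "length x = Suc (length u + r)"
    and pre: "take (Suc (length u)) x = u @ [v]"
    and vals: "\<And>p. \<lbrakk>Suc (length u) \<le> p; p < length x\<rbrakk> \<Longrightarrow> x ! p \<in> lftj_values Q \<pi> P (take p x)"
    by auto
  from pre len have "take (length u) x = u" "x ! length u = v"
    by (auto simp: take_Suc_conv_app_nth)
  with len vals v' show ?case
    by (metis Suc_leI add_Suc_right le_neq_implies_less)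
qed auto

lemma distinct_concat_map:
  assumes "distinct vs" "\<And>v. v \<in> set vs \<Longrightarrow> distinct (f v)"
    and "\<And>v w x. \<lbrakk>v \<in> set vs; w \<in> set vs; x \<in> set (f v); x \<in> set (f w)\<rbrakk> \<Longrightarrow> v = w"
  shows "distinct (concat (map f vs))"
  using assms
proof (induction vs)
  case (Cons v vs)
  have "distinct (concat (map f vs))"
    by (rule Cons.IH) (use Cons.prems in auto)
  moreover have "set (f v) \<inter> set (f w) = {}" if "w \<in> set vs" for w
    using Cons.prems(1) Cons.prems(3)[of v w] that by auto
  ultimately show ?case using Cons.prems(2)[of v] by auto
qed simp

lemma distinct_lftj: "distinct (lftj Q \<pi> P r u)"
proof (induction r arbitrary: u)
  case (Suc r)
  have "v = w" if "x \<in> set (lftj Q \<pi> P r (u @ [v]))" "x \<in> set (lftj Q \<pi> P r (u @ [w]))" for v w x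
    using that[THEN lftj_sound] by auto
  then show ?case
    by (auto intro!: distinct_concat_map Suc.IH)
qed simp

definition projection :: "('r, 'v) atom list \<Rightarrow> 'v list \<Rightarrow> nat \<Rightarrow> int list \<Rightarrow> int list" where
  "projection Q \<pi> j u = map (\<lambda>x. the (map_of (zip \<pi> u) x)) (snd (Q ! j))"

lemma full_query_atom:
  assumes "full_query ar Q \<pi>" "j < length Q"
  shows "snd (Q ! j) \<noteq> []" "length (snd (Q ! j)) = ar (fst (Q ! j))"
    "distinct (snd (Q ! j))" "set (snd (Q ! j)) \<subseteq> set \<pi>"
proof -
  have "Q ! j \<in> set Q" using assms by simp
  then show "snd (Q ! j) \<noteq> []" "length (snd (Q ! j)) = ar (fst (Q ! j))"
    using assms(1) by (auto simp: full_query_def)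
  have "subseq (snd (Q ! j)) \<pi>" "distinct \<pi>"
    using assms(1) \<open>Q ! j \<in> set Q\<close> by (auto simp: full_query_def)
  then show "distinct (snd (Q ! j))" "set (snd (Q ! j)) \<subseteq> set \<pi>"
    by (auto simp: subseq_conv_nths dest: in_set_nthsD)
qed

text \<open>The depth of the atom's last variable decides: the value enumerated there comes from a
  tuple of \<open>S\<close> that agrees with the binding on all earlier arguments, so this one tuple
  is the entire projection.\<close>

lemma lftj_projection:
  assumes query: "full_query ar Q \<pi>" and x: "x \<in> set (lftj Q \<pi> P (length \<pi>) [])"
    and S: "(j, S) \<in> set P" "j < length Q" "\<And>t. t \<in> S \<Longrightarrow> length t = ar (fst (Q ! j))"
  shows "projection Q \<pi> j x \<in> S"
proof -
  define xs where "xs = snd (Q ! j)"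
  note atom = full_query_atom[OF query S(2), folded xs_def]
  have "distinct \<pi>" using query by (simp add: full_query_def)
  from lftj_sound[OF x] have len: "length x = length \<pi>"
    and vals: "\<And>p. p < length x \<Longrightarrow> x ! p \<in> lftj_values Q \<pi> P (take p x)"
    by auto
  have "last xs \<in> set \<pi>" using atom by auto
  then obtain p where p: "p < length \<pi>" "\<pi> ! p = last xs"
    by (auto simp: in_set_conv_nth)
  have "last xs \<in> set xs" using atom by simp
  have "x ! p \<in> lftj_values Q \<pi> P (take p x)" using vals p len by simp
  moreover have "(j, S) \<in> {(j, S) \<in> set P. \<pi> ! length (take p x) \<in> set (snd (Q ! j))}"
    using S(1) p len \<open>last xs \<in> set xs\<close> by (simp add: xs_def)
  ultimately have "x ! p \<in> {t ! q | t q. t \<in> S \<and> q < length xs \<and> xs ! q = \<pi> ! length (take p x) \<and>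
      (\<forall>q'<q. map_of (zip \<pi> (take p x)) (xs ! q') = Some (t ! q'))}"
    unfolding lftj_values_def xs_def by blast
  then obtain t q where t: "t \<in> S" and q: "x ! p = t ! q" "q < length xs"
    "xs ! q = last xs" "\<And>q'. q' < q \<Longrightarrow> map_of (zip \<pi> (take p x)) (xs ! q') = Some (t ! q')"
    using p len by auto
  \<comment> \<open>No variable is repeated in an atom, so the witness position is the last one and
    all other arguments are among the \<open>q' < q\<close>.\<close>
  have "q = length xs - 1"
    using q(2,3) atom(1,3) by (simp add: last_conv_nth nth_eq_iff_index_eq)
  have "zip \<pi> x = zip \<pi> (take p x) @ zip (drop p \<pi>) (drop p x)"
    using zip_append2[of \<pi> "take p x" "drop p x"] zip_append2[of \<pi> "take p x" "[]"] p len
    by simp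
  then have "map_of (zip \<pi> x) v = Some y" if "map_of (zip \<pi> (take p x)) v = Some y" for v y
    using that p len \<open>distinct \<pi>\<close>
    by (metis Un_iff map_fst_zip map_of_SomeD map_of_eq_Some_iff set_append)
  then have "map_of (zip \<pi> x) (xs ! q') = Some (t ! q')" if "q' < q" for q'
    using q(4)[OF that] by blast
  moreover have "map_of (zip \<pi> x) (xs ! q) = Some (t ! q)"
    using p q \<open>distinct \<pi>\<close> len by (metis map_of_zip_nth)
  ultimately have "map_of (zip \<pi> x) (xs ! q') = Some (t ! q')" if "q' < length xs" for q'
    using that \<open>q = length xs - 1\<close> by (cases "q' = q") auto
  then have "projection Q \<pi> j x = t"
    using S(3)[OF t] atom(2) by (intro nth_equalityI) (auto simp: projection_def xs_def)
  with t show ?thesis by simp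
qed

text \<open>Every variable occurs in some atom, so all values of an answer occur in the finite
  relations. Without finiteness \<open>card\<close> would be \<open>0\<close> and could not bound
  the output.\<close>

lemma finite_answers:
  assumes query: "full_query ar Q \<pi>" and db: "database ar Q D"
  shows "finite (answers Q \<pi> D)"
proof -
  define V where "V = (\<Union>R\<in>fst ` set Q. \<Union>t\<in>D R. set t)"
  have "finite V" using db by (auto simp: V_def database_def)
  have "set u \<subseteq> V" if u: "u \<in> answers Q \<pi> D" for u
  proof
    fix v assume "v \<in> set u"
    then obtain p where p: "p < length u" "u ! p = v" by (auto simp: in_set_conv_nth)
    have "length u = length \<pi>" using u by (simp add: answers_def)
    with p have "\<pi> ! p \<in> set \<pi>" by simp
    also have "set \<pi> = (\<Union>(R, xs)\<in>set Q. set xs)" using query by (simp add: full_query_def)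
    finally obtain R xs where R: "(R, xs) \<in> set Q" "\<pi> ! p \<in> set xs" by auto
    have "map_of (zip \<pi> u) (\<pi> ! p) = Some v"
      using p query \<open>length u = length \<pi>\<close> map_of_zip_nth[of \<pi> u p] by (simp add: full_query_def)
    then have "v \<in> set (map (\<lambda>x. the (map_of (zip \<pi> u) x)) xs)"
      using R by force
    moreover have "map (\<lambda>x. the (map_of (zip \<pi> u) x)) xs \<in> D R"
      using u R by (auto simp: answers_def)
    ultimately show "v \<in> V" using R unfolding V_def by force
  qed
  then have "answers Q \<pi> D \<subseteq> {u. set u \<subseteq> V \<and> length u = length \<pi>}"
    by (auto simp: answers_def)
  then show ?thesis
    using finite_lists_length_eq[OF \<open>finite V\<close>] finite_subset by blast
qed

section \<open>Executions\<close>

fun outputs :: "'r event list \<Rightarrow> int list list" where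
  "outputs [] = []"
| "outputs (Output u # tr) = u # outputs tr"
| "outputs (Read R c x # tr) = outputs tr"
| "outputs (Spill j s # tr) = outputs tr"

definition reads :: "'r event list \<Rightarrow> nat" where
  "reads tr = length (filter (\<lambda>e. \<exists>R c x. e = Read R c x) tr)"

lemma length_outputs: "length (filter (\<lambda>e. \<exists>u. e = Output u) tr) = length (outputs tr)"
  by (induction tr rule: outputs.induct) auto

lemma outputs_append [simp]: "outputs (tr @ tr') = outputs tr @ outputs tr'"
  by (induction tr rule: outputs.induct) auto

lemma outputs_map_Output [simp]: "outputs (map Output us) = us"
  by (induction us) auto

lemma outputs_eq_Nil: "(\<And>u. Output u \<notin> set tr) \<Longrightarrow> outputs tr = []"
  by (induction tr rule: outputs.induct) auto

lemma reads_append [simp]: "reads (tr @ tr') = reads tr + reads tr'"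
  by (simp add: reads_def)

lemma reads_map_Output [simp]: "reads (map Output us) = 0"
  by (simp add: reads_def)

lemma reads_le_length: "reads tr \<le> length tr"
  by (simp add: reads_def)

lemma spill_free_append [simp]: "spill_free (tr @ tr') \<longleftrightarrow> spill_free tr \<and> spill_free tr'"
  by (auto simp: spill_free_def)

lemma length_concat_le:
  assumes "\<And>x. x \<in> set xs \<Longrightarrow> length (f x) \<le> c"
  shows "length (concat (map f xs)) \<le> length xs * c"
  using assms by (induction xs) (auto intro!: add_mono)

context boxed_lftj
begin

text \<open>The atoms not yet provisioned at dimension \<open>i\<close> of a spill-free execution.\<close>

definition pending :: "nat \<Rightarrow> (nat \<times> int list) list" where
  "pending i = filter (\<lambda>(j, s). \<forall>i'<i. snd (Q ! j) ! 0 \<noteq> \<pi> ! i') (map (\<lambda>j. (j, [])) [0..<length Q])"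

lemma pendingD: "(j, s) \<in> set (pending i) \<Longrightarrow> s = [] \<and> j < length Q"
  by (auto simp: pending_def)

lemma pending_0: "pending 0 = map (\<lambda>j. (j, [])) [0..<length Q]"
  by (simp add: pending_def)

lemma set_handled_subset: "set (handled i todo) \<subseteq> set todo"
  by (auto simp: handled_def)

lemma handledD: "(j, s) \<in> set (handled i (pending i)) \<Longrightarrow> s = [] \<and> j < length Q"
  using set_handled_subset pendingD by blast

lemma length_handled_le: "length (handled i (pending i)) \<le> length Q"
proof -
  have "length (handled i (pending i)) \<le> length (pending i)"
    by (simp add: handled_def)
  also have "\<dots> \<le> length Q"
    unfolding pending_def by (rule order.trans[OF length_filter_le]) simp
  finally show ?thesis .
qed

lemma kept_eq_handled: "spilled i todo w low = [] \<Longrightarrow> kept i todo w low = handled i todo"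
  unfolding kept_def spilled_def by (simp add: filter_id_conv filter_empty_conv)

text \<open>Each iteration logs its spills among its probe events, so a property of the trace
  becomes one of the state.\<close>

lemma box_loop_not_spilled:
  assumes "box_loop i todo P w low cache tr" "spill_free tr"
  shows "spilled i todo w low = []"
proof (rule ccontr)
  assume "spilled i todo w low \<noteq> []"
  then obtain j s where "(j, s) \<in> set (spilled i todo w low)" by (cases "spilled i todo w low") auto
  then have "Spill j s \<in> set (probe_events i todo w low)"
    by (force simp: probe_events_def)
  moreover have "set (probe_events i todo w low) \<subseteq> set tr"
    using assms(1) by (cases rule: box_loop.cases) auto
  ultimately show False using assms(2) by (auto simp: spill_free_def)
qed

lemma outputs_probe_events [simp]: "outputs (probe_events i todo w low) = []"
  by (rule outputs_eq_Nil) (auto simp: probe_events_def)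

lemma outputs_provision_events [simp]: "outputs (provision_events i todo w low cache) = []"
  by (rule outputs_eq_Nil) (auto simp: provision_events_def)

end

locale boxed_lftj_input = boxed_lftj Q \<pi> ar D M B
  for Q :: "('r, 'v) atom list" and \<pi> ar D M B +
  assumes query: "full_query ar Q \<pi>" and database: "database ar Q D" and B_pos: "0 < B"
begin

lemma atom:
  assumes "j < length Q"
  shows "snd (Q ! j) \<noteq> []" "length (snd (Q ! j)) = ar (symbol j)" "0 < ar (symbol j)"
    "distinct (snd (Q ! j))" "set (snd (Q ! j)) \<subseteq> set \<pi>"
  using full_query_atom[OF query assms] by (auto simp: symbol_def simp flip: length_greater_0_conv)

lemma finite_rel: "j < length Q \<Longrightarrow> finite (rel j)"
  using database by (auto simp: database_def rel_def symbol_def)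

lemma length_rel: "j < length Q \<Longrightarrow> t \<in> rel j \<Longrightarrow> length t = ar (symbol j)"
  using database by (auto simp: database_def rel_def symbol_def)

lemma rel_not_Nil: "j < length Q \<Longrightarrow> t \<in> rel j \<Longrightarrow> t \<noteq> []"
  using length_rel atom(3) by fastforce

lemma handled_pending: "handled i (pending i) = filter (\<lambda>(j, s). snd (Q ! j) ! 0 = \<pi> ! i) (pending i)"
  unfolding handled_def using pendingD atom(3) by (intro filter_cong refl) fastforce

lemma pending_Suc: "pending (Suc i) = filter (\<lambda>A. A \<notin> set (handled i (pending i))) (pending i)"
proof -
  have "pending (Suc i) = filter (\<lambda>(j, s). snd (Q ! j) ! 0 \<noteq> \<pi> ! i) (pending i)"
    unfolding pending_def filter_filter by (intro filter_cong) (auto simp: less_Suc_eq)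
  also have "\<dots> = filter (\<lambda>A. A \<notin> set (handled i (pending i))) (pending i)"
    unfolding handled_pending by (intro filter_cong) auto
  finally show ?thesis .
qed

lemma remaining_pending: "spilled i (pending i) w low = [] \<Longrightarrow> remaining i (pending i) w low = pending (Suc i)"
  by (simp add: remaining_def pending_Suc)

lemma first_variable:
  assumes "j < length Q"
  obtains i where "i < length \<pi>" "snd (Q ! j) ! 0 = \<pi> ! i"
  using atom[OF assms] by (metis in_set_conv_nth length_greater_0_conv nth_mem subsetD)

lemma pending_length: "pending (length \<pi>) = []"
proof -
  have "False" if "(j, s) \<in> set (pending (length \<pi>))" for j s
    using that first_variable[of j] by (fastforce simp: pending_def)
  then show ?thesis by (cases "pending (length \<pi>)") auto
qed

lemma low_le_high:
  assumes "spilled i (pending i) w low = []"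
  shows "low \<le> high i (pending i) w low"
proof -
  have "low \<le> the (probe_atom i (pending i) w low A)" if A: "A \<in> set (handled i (pending i))" for A
  proof -
    obtain j where j: "A = (j, [])" "j < length Q" using A handledD by (metis surj_pair)
    from A assms obtain g where g: "probe_atom i (pending i) w low A = Some g"
      by (auto simp: spilled_def filter_empty_conv)
    with probe_SomeD(1)[OF finite_rel[OF j(2)] B_pos] j show ?thesis
      by (simp add: probe_atom_def)
  qed
  then show ?thesis using assms by (auto simp: high_def)
qed

lemma high_fits:
  assumes "spilled i (pending i) w low = []" "(j, s) \<in> set (handled i (pending i))"
  shows "trie_words (ar (symbol j)) (slice (rel j) [] low (high i (pending i) w low))
    \<le> budget i (pending i) w * B"
proof -
  have j: "s = []" "j < length Q" using assms(2) handledD by auto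
  from assms obtain g where g: "probe_atom i (pending i) w low (j, s) = Some g"
    by (auto simp: spilled_def filter_empty_conv)
  have "high i (pending i) w low \<le> the (probe_atom i (pending i) w low (j, s))"
    using assms by (auto simp: high_def intro!: Min_le)
  then have "high i (pending i) w low \<le> g" using g by simp
  then have "trie_words (ar (symbol j)) (slice (rel j) [] low (high i (pending i) w low))
      \<le> trie_words (ar (symbol j)) (slice (rel j) [] low g)"
    using j finite_subset[OF slice_subset finite_rel] by (intro trie_words_mono slice_mono) auto
  also have "\<dots> \<le> budget i (pending i) w * B"
    using probe_SomeD(2)[OF finite_rel[OF j(2)] B_pos] g j by (simp add: probe_atom_def)
  finally show ?thesis .
qed

subsection \<open>Output\<close>

definition covers :: "nat \<Rightarrow> (nat \<times> int list set) list \<Rightarrow> bool" where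
  "covers i P \<longleftrightarrow> (\<forall>(j, S)\<in>set P. j < length Q \<and> S \<subseteq> rel j) \<and>
     (\<forall>j<length Q. (j, []) \<notin> set (pending i) \<longrightarrow> (\<exists>S. (j, S) \<in> set P))"

text \<open>The last conjunct survives when slices are dropped from \<open>P\<close> on the way back
  up; at the outermost call \<open>P\<close> is empty, and this conjunct gives membership in
  \<open>answers\<close>.\<close>

definition in_box :: "(nat \<times> int list set) list \<Rightarrow> int list \<Rightarrow> bool" where
  "in_box P u \<longleftrightarrow> length u = length \<pi> \<and> (\<forall>(j, S)\<in>set P. projection Q \<pi> j u \<in> S) \<and>
     (\<forall>j<length Q. projection Q \<pi> j u \<in> rel j)"

lemma covers_provisioned:
  assumes "covers i P" "spilled i (pending i) w low = []"
  shows "covers (Suc i) (P @ provisioned i (pending i) w low)"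
  unfolding covers_def
proof (intro conjI allI impI)
  show "\<forall>(j, S)\<in>set (P @ provisioned i (pending i) w low). j < length Q \<and> S \<subseteq> rel j"
    using assms handledD slice_subset
    by (fastforce simp: covers_def provisioned_def kept_eq_handled)
next
  fix j assume j: "j < length Q" "(j, []) \<notin> set (pending (Suc i))"
  show "\<exists>S. (j, S) \<in> set (P @ provisioned i (pending i) w low)"
  proof (cases "(j, []) \<in> set (pending i)")
    case True
    with j have "(j, []) \<in> set (handled i (pending i))" by (simp add: pending_Suc)
    then show ?thesis using assms by (force simp: provisioned_def kept_eq_handled)
  next
    case False
    with j assms show ?thesis by (auto simp: covers_def)
  qed
qed

lemma in_box_lftj:
  assumes "covers (length \<pi>) P" "u \<in> set (lftj Q \<pi> P (length \<pi>) [])"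
  shows "in_box P u"
proof -
  have "projection Q \<pi> j u \<in> S" if "(j, S) \<in> set P" for j S
  proof (rule lftj_projection[OF query assms(2) that])
    show "j < length Q" using that assms(1) by (auto simp: covers_def)
    then show "length t = ar (fst (Q ! j))" if "t \<in> S" for t
      using that \<open>(j, S) \<in> set P\<close> assms(1) length_rel by (fastforce simp: covers_def symbol_def)
  qed
  moreover have "projection Q \<pi> j u \<in> rel j" if j: "j < length Q" for j
  proof -
    obtain S where "(j, S) \<in> set P" using j assms(1) by (auto simp: covers_def pending_length)
    with calculation assms(1) show ?thesis by (fastforce simp: covers_def)
  qed
  moreover have "length u = length \<pi>" using lftj_sound[OF assms(2)] by simp
  ultimately show ?thesis by (auto simp: in_box_def)
qed

lemma in_box_provisioned:
  assumes "in_box (P @ provisioned i (pending i) w low) u" "spilled i (pending i) w low = []"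
  shows "in_box P u"
    and "(j, s) \<in> set (handled i (pending i)) \<Longrightarrow>
      low \<le> Fin (projection Q \<pi> j u ! 0) \<and> Fin (projection Q \<pi> j u ! 0) \<le> high i (pending i) w low"
proof -
  show "in_box P u" using assms by (auto simp: in_box_def)
  assume h: "(j, s) \<in> set (handled i (pending i))"
  then have "(j, slice (rel j) s low (high i (pending i) w low)) \<in> set (provisioned i (pending i) w low)"
    using assms by (force simp: provisioned_def kept_eq_handled)
  then have "projection Q \<pi> j u \<in> slice (rel j) s low (high i (pending i) w low)"
    using assms by (auto simp: in_box_def)
  then show "low \<le> Fin (projection Q \<pi> j u ! 0) \<and> Fin (projection Q \<pi> j u ! 0) \<le> high i (pending i) w low"
    using handledD[OF h] by (simp add: slice_Nil)
qed

lemma high_no_atoms: "handled i todo = [] \<Longrightarrow> high i todo w low = Pinf"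
  by (simp add: high_def spilled_def)

text \<open>The lower bound on the first values of handled atoms is the strengthening that separates
  an iteration from all later ones of the same pass.\<close>

lemma
  box_up_outputs: "box_up i todo P w tr \<Longrightarrow> todo = pending i \<Longrightarrow> covers i P \<Longrightarrow> spill_free tr \<Longrightarrow>
    distinct (outputs tr) \<and> (\<forall>u\<in>set (outputs tr). in_box P u)"
  and box_loop_outputs: "box_loop i todo P w low cache tr \<Longrightarrow>
    todo = pending i \<Longrightarrow> covers i P \<Longrightarrow> spill_free tr \<Longrightarrow>
    distinct (outputs tr) \<and> (\<forall>u\<in>set (outputs tr). in_box P u \<and>
      (\<forall>(j, s)\<in>set (handled i todo). low \<le> Fin (projection Q \<pi> j u ! 0)))"
proof (induction rule: box_up_box_loop.inducts)
  case (join todo P w)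
  then show ?case using distinct_lftj in_box_lftj by auto
next
  case (pass i todo P w tr)
  then show ?case by auto
next
  case (last i todo w low e P tr cache)
  have sp: "spilled i todo w low = []"
    using box_loop_not_spilled[OF box_up_box_loop.last[OF last.IH(1,2,3,5)]] last.prems by blast
  have IH: "distinct (outputs tr)" "\<And>u. u \<in> set (outputs tr) \<Longrightarrow> in_box (P @ provisioned i todo w low) u"
    using last sp by (auto simp: remaining_pending covers_provisioned)
  then show ?case
    using in_box_provisioned sp last.prems(1) by fastforce
next
  case (iterate i todo w low e P tr h cache tr')
  have sp: "spilled i todo w low = []"
    using box_loop_not_spilled[OF box_up_box_loop.iterate[OF iterate.IH(1,2,3,5,6)]] iterate.prems by blast
  have IH: "distinct (outputs tr)" "\<And>u. u \<in> set (outputs tr) \<Longrightarrow> in_box (P @ provisioned i todo w low) u"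
    using iterate sp by (auto simp: remaining_pending covers_provisioned)
  have IH': "distinct (outputs tr')" "\<And>u. u \<in> set (outputs tr') \<Longrightarrow> in_box P u"
    "\<And>u j s. u \<in> set (outputs tr') \<Longrightarrow> (j, s) \<in> set (handled i todo) \<Longrightarrow>
      Fin (h + 1) \<le> Fin (projection Q \<pi> j u ! 0)"
    using iterate by auto
  \<comment> \<open>A finite \<open>h\<close> is only possible if some atom is handled. The first
    value of its projection is at most \<open>h\<close> in this iteration and at least
    \<open>h + 1\<close> in later ones, so no tuple is repeated.\<close>
  obtain j s where js: "(j, s) \<in> set (handled i todo)"
    using high_no_atoms[of i todo w low] iterate.IH(5) by (cases "handled i todo") auto
  have "low \<le> Fin h"
    using low_le_high sp iterate.prems(1) iterate.IH(5) by metis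
  then have "low \<le> Fin (h + 1)" by (rule order.trans) simp
  have "u \<notin> set (outputs tr')" if "u \<in> set (outputs tr)" for u
  proof
    assume "u \<in> set (outputs tr')"
    from IH'(3)[OF this js] in_box_provisioned(2)[of P i w low u j s] IH(2)[OF that] sp js
    show False using iterate.prems(1) iterate.IH(5) by auto
  qed
  then have "distinct (outputs tr @ outputs tr')"
    using IH(1) IH'(1) by auto
  moreover have "in_box P u \<and> (\<forall>(j, s)\<in>set (handled i todo). low \<le> Fin (projection Q \<pi> j u ! 0))"
    if "u \<in> set (outputs tr)" for u
    using in_box_provisioned sp IH(2)[OF that] iterate.prems(1) by fastforce
  moreover have "in_box P u \<and> (\<forall>(j, s)\<in>set (handled i todo). low \<le> Fin (projection Q \<pi> j u ! 0))"
    if "u \<in> set (outputs tr')" for u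
    using IH'(2,3)[OF that] \<open>low \<le> Fin (h + 1)\<close> order.trans by blast
  ultimately show ?case
    by (simp add: ball_Un del: distinct_append)
qed

lemma length_outputs_le:
  assumes "execution tr" "spill_free tr"
  shows "length (outputs tr) \<le> card (answers Q \<pi> D)"
proof -
  have "covers 0 []" by (simp add: covers_def pending_0)
  from box_up_outputs[OF assms(1)[unfolded execution_def] pending_0[symmetric] this assms(2)]
  have dist: "distinct (outputs tr)" and box: "\<And>u. u \<in> set (outputs tr) \<Longrightarrow> in_box [] u" by auto
  have "set (outputs tr) \<subseteq> answers Q \<pi> D"
  proof
    fix u assume "u \<in> set (outputs tr)"
    from box[OF this] show "u \<in> answers Q \<pi> D"
      by (auto simp: in_box_def answers_def projection_def rel_def symbol_def in_set_conv_nth)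
        (metis fst_conv snd_conv)
  qed
  with finite_answers[OF query database] have "card (set (outputs tr)) \<le> card (answers Q \<pi> D)"
    by (rule card_mono)
  with dist show ?thesis by (simp add: distinct_card)
qed

subsection \<open>Blocks read in one iteration\<close>

text \<open>In units of \<open>a * (b + 1)\<close> per atom, the factor 4 is 1 for the probe, at
  most 1 for locating the bound in one array, and 2 for copying at most \<open>2 * a\<close>
  ranges.\<close>

lemma reads_iteration:
  assumes sp: "spilled i (pending i) w low = []"
    and ar: "\<And>j. j < length Q \<Longrightarrow> ar (symbol j) \<le> a"
  shows "reads (probe_events i (pending i) w low @ provision_events i (pending i) w low cache)
    \<le> length (handled i (pending i)) * (4 * a * Suc (budget i (pending i) w))"
proof -
  let ?H = "handled i (pending i)" and ?h = "high i (pending i) w low"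
  define b where "b = budget i (pending i) w"
  have probe: "reads (probe_events i (pending i) w low) \<le> length ?H * (a * Suc b)"
  proof -
    have "reads (probe_events i (pending i) w low) \<le> length (concat (map (\<lambda>(j, s). map (\<lambda>(c, x). Read (symbol j) c x)
         (fetched_blocks B (probe_reads B b (ar (symbol j)) (rel j) s low))) ?H) :: 'r event list)"
      using sp by (simp add: probe_events_def reads_le_length b_def)
    also have "\<dots> \<le> length ?H * (a * Suc b)"
    proof (rule length_concat_le, clarify)
      fix j s assume js: "(j, s) \<in> set ?H"
      then have j: "s = []" "j < length Q" using handledD by auto
      have "length (fetched_blocks B (probe_reads B b (ar (symbol j)) (rel j) [] low)) \<le> ar (symbol j) * Suc b"
        by (rule length_fetched_probe_reads[OF finite_rel[OF j(2)] B_pos atom(3)[OF j(2)]])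
      also have "\<dots> \<le> a * Suc b" using ar[OF j(2)] by (rule mult_le_mono1)
      finally show "length (map (\<lambda>(c, x). Read (symbol j) c x :: 'r event)
         (fetched_blocks B (probe_reads B b (ar (symbol j)) (rel j) s low))) \<le> a * Suc b"
        using j by simp
    qed
    finally show ?thesis .
  qed
  let ?locate = "concat (map (\<lambda>(j, s). map (\<lambda>(c, x). Read (symbol j) c x)
         (fetched_blocks B (locate_reads B b (rel j) s low ?h))) ?H) :: 'r event list"
  let ?ranges = "\<lambda>(j, s). map (Pair j) (slice_ranges (ar (symbol j)) (rel j) s low ?h)"
  let ?copy = "concat (map (\<lambda>(j, c, x, y). map (Read (symbol j) c)
         (filter (\<lambda>z. cache (j, c) \<noteq> Some z) [x div B..<Suc ((y - 1) div B)]))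
       (concat (map ?ranges ?H))) :: 'r event list"
  have "provision_events i (pending i) w low cache = ?locate @ ?copy"
    using sp by (simp add: provision_events_def kept_ranges_def kept_eq_handled b_def)
  moreover have "length ?locate \<le> length ?H * Suc b"
    using handledD length_fetched_locate_reads[OF B_pos, of b]
    by (intro length_concat_le) fastforce
  moreover have "length ?copy \<le> length (concat (map ?ranges ?H)) * Suc b"
  proof (rule length_concat_le, clarify)
    fix j c x y assume "(j, c, x, y) \<in> set (concat (map ?ranges ?H))"
    then obtain s where js: "(j, s) \<in> set ?H"
      and r: "(c, x, y) \<in> set (slice_ranges (ar (symbol j)) (rel j) s low ?h)"
      by auto
    then have j: "s = []" "j < length Q" using handledD by auto
    \<comment> \<open>A range is no longer than the slice has words, and the slice fits the budget;
      cached blocks only shorten the list.\<close>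
    have "y - x \<le> trie_words (ar (symbol j)) (slice (rel j) [] low ?h)"
      using r rel_not_Nil[OF j(2)] unfolding j(1) by (intro slice_ranges_bound[OF finite_rel[OF j(2)]])
    also have "\<dots> \<le> b * B" unfolding b_def by (rule high_fits[OF sp js])
    finally have "(y - 1) div B \<le> (x + b * B) div B" by (intro div_le_mono) simp
    then have "(y - 1) div B \<le> x div B + b" using B_pos by simp
    then have "length [x div B..<Suc ((y - 1) div B)] \<le> Suc b" unfolding length_upt by linarith
    then show "length (map (Read (symbol j) c :: nat \<Rightarrow> 'r event)
        (filter (\<lambda>z. cache (j, c) \<noteq> Some z) [x div B..<Suc ((y - 1) div B)])) \<le> Suc b"
      unfolding length_map by (rule order.trans[OF length_filter_le])
  qed
  moreover have "length (concat (map ?ranges ?H)) \<le> length ?H * (2 * a)"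
  proof (rule length_concat_le, clarify)
    fix j s assume "(j, s) \<in> set ?H"
    then have "j < length Q" using handledD by auto
    then show "length (map (Pair j) (slice_ranges (ar (symbol j)) (rel j) s low ?h)) \<le> 2 * a"
      using length_slice_ranges[of "ar (symbol j)" "rel j" s low ?h] ar[of j] by simp
  qed
  ultimately have "reads (provision_events i (pending i) w low cache) \<le>
      length ?H * Suc b + length ?H * (2 * a) * Suc b"
    using reads_le_length[of ?locate] reads_le_length[of ?copy]
    by (smt (verit) add_mono mult_le_mono1 order.trans reads_append)
  moreover have "length ?H * Suc b \<le> length ?H * (a * Suc b)"
  proof (cases "?H = []")
    case False
    then obtain j s where "(j, s) \<in> set ?H" by (cases ?H) auto
    then have "0 < a" using ar[of j] atom(3)[of j] handledD by fastforce
    then have "1 * Suc b \<le> a * Suc b" by (intro mult_le_mono1) simp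
    then show ?thesis by (intro mult_le_mono2) simp
  qed simp
  moreover have "length ?H * (2 * a) * Suc b = 2 * (length ?H * (a * Suc b))"
    and "length ?H * (4 * a * Suc b) = 4 * (length ?H * (a * Suc b))"
    by (simp_all only: mult_ac)
  ultimately show ?thesis using probe unfolding b_def[symmetric] reads_append by linarith
qed

subsection \<open>Number of iterations\<close>

text \<open>Of the factor 4, one 2 pays for rounding the budget down to whole blocks, the other for
  passing from words to nodes; \<open>length Q\<close> bounds the number of atoms sharing the
  memory.\<close>

definition iteration_nodes :: real where
  "iteration_nodes = real dimension_memory / (4 * real (length Q))"

text \<open>Counting the tuples above \<open>low\<close> once with and once without \<open>low\<close> itself accounts for the fact
  that only two consecutive slices together are known to exceed the budget.\<close>

definition nodes_left :: "nat \<Rightarrow> int extended \<Rightarrow> nat" where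
  "nodes_left i low = (\<Sum>(j, s)\<in>set (handled i (pending i)).
     trie_nodes (ar (symbol j)) {t \<in> rel j. low \<le> Fin (t ! 0)} +
     trie_nodes (ar (symbol j)) {t \<in> rel j. low < Fin (t ! 0)})"

lemma nodes_left_le:
  assumes "\<And>j. j < length Q \<Longrightarrow> trie_words (ar (symbol j)) (rel j) \<le> I"
  shows "nodes_left i low \<le> 2 * length Q * I"
proof -
  have "nodes_left i low \<le> (\<Sum>A\<in>set (handled i (pending i)). 2 * I)"
    unfolding nodes_left_def
  proof (rule sum_mono, clarify)
    fix j s assume "(j, s) \<in> set (handled i (pending i))"
    then have j: "j < length Q" using handledD by auto
    have "trie_nodes (ar (symbol j)) {t \<in> rel j. p t} \<le> I" for p
      using trie_nodes_mono[of "{t \<in> rel j. p t}" "rel j" "ar (symbol j)"] finite_rel[OF j] assms[OF j]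
      by (auto simp: trie_words_eq)
    from add_mono[OF this this]
    show "trie_nodes (ar (symbol j)) {t \<in> rel j. low \<le> Fin (t ! 0)} +
        trie_nodes (ar (symbol j)) {t \<in> rel j. low < Fin (t ! 0)} \<le> 2 * I"
      by (simp add: mult_2)
  qed
  also have "\<dots> \<le> length Q * (2 * I)"
    using card_length[of "handled i (pending i)"] length_handled_le[of i] by simp
  finally show ?thesis by (simp add: algebra_simps)
qed

lemma budget_ge:
  assumes "dimension_memory \<le> w" "1 \<le> budget i (pending i) w"
  shows "2 * iteration_nodes \<le> real (budget i (pending i) w * B)"
proof -
  let ?b = "budget i (pending i) w" and ?l = "length (handled i (pending i))"
  have pos: "0 < ?l * B" using assms(2) by (cases "?l * B") (auto simp: budget_def)
  have "w < (?b + 1) * (?l * B)"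
    unfolding budget_def using pos by (metis Suc_eq_plus1 dividend_less_div_times mult_Suc add.commute)
  also have "\<dots> \<le> 2 * ?b * (?l * B)" using assms(2) by (intro mult_le_mono1) simp
  also have "\<dots> \<le> 2 * ?b * (length Q * B)" using length_handled_le by (intro mult_le_mono2 mult_le_mono1)
  finally have "dimension_memory \<le> 2 * length Q * (?b * B)" using assms(1) by (simp add: algebra_simps)
  then have "real dimension_memory \<le> real (2 * length Q * (?b * B))" by (rule of_nat_mono)
  moreover have "0 < length Q" using pos length_handled_le[of i] by (cases "length Q") auto
  ultimately show ?thesis by (simp add: iteration_nodes_def field_simps)
qed

text \<open>Consider an atom whose probe returned \<open>h\<close>. Its slice from
  \<open>low\<close> to \<open>h + 1\<close> exceeds the budget and is disjoint from the tuples
  above \<open>h + 1\<close>, so the first of its two counts drops by the nodes of that slice. Its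
  other count passes from the tuples above \<open>low\<close> to those from \<open>h + 1\<close> on
  and does not grow.\<close>

lemma nodes_left_decrease:
  assumes sp: "spilled i (pending i) w low = []" and high: "high i (pending i) w low = Fin h"
    and sp': "spilled i (pending i) w (Fin (h + 1)) = []" and w: "dimension_memory \<le> w"
  shows "iteration_nodes + nodes_left i (Fin (h + 1)) \<le> nodes_left i low"
proof -
  let ?H = "set (handled i (pending i))"
  define b where "b = budget i (pending i) w"
  define g where "g A = (case A of (j, s) \<Rightarrow> \<lambda>low.
     trie_nodes (ar (symbol j)) {t \<in> rel j. low \<le> Fin (t ! 0)} +
     trie_nodes (ar (symbol j)) {t \<in> rel j. low < Fin (t ! 0)})" for A :: "nat \<times> int list"
  have left: "nodes_left i l = (\<Sum>A\<in>?H. g A l)" for l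
    unfolding nodes_left_def g_def by (intro sum.cong) auto
  have "low \<le> Fin h" using low_le_high[OF sp] high by simp
  then have low: "low < Fin (h + 1)" by (rule order.strict_trans1) simp
  have above: "low < Fin v" "low \<le> Fin v" if "h + 1 \<le> v" for v
    using order.strict_trans2[OF low, of "Fin v"] that by auto
  have g_mono: "g A (Fin (h + 1)) \<le> g A low" if A: "A \<in> ?H" for A
  proof -
    obtain j s where "A = (j, s)" by (cases A)
    with A finite_rel[of j] handledD have "finite {t \<in> rel j. p t}" for p by fastforce
    then show ?thesis unfolding g_def \<open>A = (j, s)\<close> split
      using above less_imp_le
      by (intro add_mono trie_nodes_mono) auto
  qed
  have "\<exists>A\<in>?H. probe_atom i (pending i) w low A = Some (Fin h)"
  proof -
    have "Fin h \<in> insert Pinf ((\<lambda>A. the (probe_atom i (pending i) w low A)) ` ?H)"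
      using high sp Min_in[of "insert Pinf ((\<lambda>A. the (probe_atom i (pending i) w low A)) ` ?H)"]
      by (simp add: high_def split: if_splits)
    then obtain A where "A \<in> ?H" "the (probe_atom i (pending i) w low A) = Fin h" by auto
    moreover from this sp have "probe_atom i (pending i) w low A \<noteq> None"
      by (auto simp: spilled_def filter_empty_conv)
    ultimately show ?thesis by force
  qed
  then obtain j s where js: "(j, s) \<in> ?H" and "probe_atom i (pending i) w low (j, s) = Some (Fin h)"
    by auto
  with handledD have j: "s = []" "j < length Q" by auto
  define k where "k = ar (symbol j)"
  let ?S = "\<lambda>l h. slice (rel j) [] l h"
  have fin: "finite (rel j)" and finS: "finite (?S l h')" for l h'
    using finite_rel[OF j(2)] finite_subset[OF slice_subset] by auto
  have probe: "probe B b k (rel j) [] low = Some (Fin h)"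
    using \<open>probe_atom i (pending i) w low (j, s) = Some (Fin h)\<close> j
    by (simp add: probe_atom_def b_def k_def)
  note fits = probe_SomeD(2)[OF fin B_pos probe]
  have exceeds: "b * B < trie_words k (?S low (Fin (h + 1)))"
    by (rule probe_SomeD(3)[OF fin B_pos probe]) simp
  \<comment> \<open>An empty slice would equal the one up to \<open>h\<close>, which fits.\<close>
  have nonempty: "?S low (Fin (h + 1)) \<noteq> {}"
  proof
    assume "?S low (Fin (h + 1)) = {}"
    then have "?S low (Fin (h + 1)) = ?S low (Fin h)"
      using slice_mono[of "Fin h" "Fin (h + 1)" "rel j" "[]" low] by auto
    with fits exceeds show False by simp
  qed
  \<comment> \<open>With budget \<open>0\<close>, fitting slices contain no tuple. As the next probe
    succeeds as well, the slices up to \<open>h\<close> and from \<open>h + 1\<close> on are both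
    empty, contradicting \<open>nonempty\<close>.\<close>
  have "1 \<le> b"
  proof (rule ccontr)
    assume "\<not> 1 \<le> b"
    then have "b = 0" by simp
    from js sp' j obtain g' where g': "probe B b k (rel j) [] (Fin (h + 1)) = Some g'"
      by (auto simp: spilled_def filter_empty_conv probe_atom_def b_def k_def)
    have empty: "?S l h' = {}" if "trie_words k (?S l h') \<le> b * B" for l h'
      using arity_le_trie_nodes[OF _ finS, of l h' k] that \<open>b = 0\<close> atom(3)[OF j(2)]
      by (auto simp: trie_words_eq k_def)
    have "?S low (Fin (h + 1)) \<subseteq> ?S low (Fin h) \<union> ?S (Fin (h + 1)) g'"
      using order.trans[OF _ probe_SomeD(1)[OF fin B_pos g']] by (auto simp: slice_Nil)
    with empty[OF fits] empty[OF probe_SomeD(2)[OF fin B_pos g']] nonempty show False by auto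
  qed
  from arity_le_trie_nodes[OF nonempty finS, of k] exceeds
  \<comment> \<open>The slice is nonempty, so its \<open>k - 1\<close> sentinels number fewer than
    its nodes.\<close>
  have "b * B \<le> 2 * trie_nodes k (?S low (Fin (h + 1)))"
    by (simp add: trie_words_eq)
  then have "real (b * B) \<le> real (2 * trie_nodes k (?S low (Fin (h + 1))))" by (rule of_nat_mono)
  with budget_ge[OF w \<open>1 \<le> b\<close>[unfolded b_def]]
  have nodes: "iteration_nodes \<le> trie_nodes k (?S low (Fin (h + 1)))"
    by (simp add: b_def)
  have "trie_nodes k (?S low (Fin (h + 1))) + trie_nodes k {t \<in> rel j. Fin (h + 1) < Fin (t ! 0)}
      \<le> trie_nodes k {t \<in> rel j. low \<le> Fin (t ! 0)}"
    using above fin by (intro trie_nodes_disjoint) (auto simp: slice_Nil)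
  moreover have "trie_nodes k {t \<in> rel j. Fin (h + 1) \<le> Fin (t ! 0)} \<le>
      trie_nodes k {t \<in> rel j. low < Fin (t ! 0)}"
    using above fin by (intro trie_nodes_mono) auto
  ultimately have dec: "trie_nodes k (?S low (Fin (h + 1))) + g (j, s) (Fin (h + 1)) \<le> g (j, s) low"
    unfolding g_def k_def by simp
  have "trie_nodes k (?S low (Fin (h + 1))) + nodes_left i (Fin (h + 1)) \<le> nodes_left i low"
    unfolding left using sum_mono[of "?H - {(j, s)}" "\<lambda>A. g A (Fin (h + 1))" "\<lambda>A. g A low"] g_mono dec
    by (simp add: sum.remove[OF _ js])
  with nodes show ?thesis by linarith
qed

subsection \<open>Total number of blocks read\<close>

text \<open>The rank counts variables from 1 and dimensions are counted from 0, so dimension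
  \<open>i\<close> belongs to rank \<open>i + 1\<close>.\<close>

lemma handled_beyond_rank:
  assumes "rank Q \<pi> \<le> i" "i < length \<pi>"
  shows "handled i (pending i) = []"
proof -
  have "False" if js: "(j, s) \<in> set (handled i (pending i))" for j s
  proof -
    have j: "j < length Q" "snd (Q ! j) ! 0 = \<pi> ! i" using js handledD by (auto simp: handled_pending)
    let ?J = "{r. 1 \<le> r \<and> r \<le> length \<pi> \<and> (\<exists>(R, xs)\<in>set Q. hd xs = \<pi> ! (r - 1))}"
    have "Q ! j \<in> set Q" "hd (snd (Q ! j)) = \<pi> ! i"
      using j atom(1)[of j] by (auto simp: hd_conv_nth)
    then have "Suc i \<in> ?J" using assms(2) by (auto intro!: bexI[of _ "Q ! j"])
    moreover have "finite ?J" by (rule finite_subset[of _ "{..length \<pi>}"]) auto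
    ultimately have "Suc i \<le> rank Q \<pi>" unfolding rank_def by (intro Max_ge)
    with assms(1) show False by simp
  qed
  then show ?thesis by (cases "handled i (pending i)") auto
qed

text \<open>Otherwise no dimension would handle an atom and all of \<open>Q\<close> would still be
  pending at the end. Positivity makes the exponent \<open>rank Q \<pi> - 1\<close> a genuine
  difference.\<close>

lemma rank_pos: "1 \<le> rank Q \<pi>"
proof (rule ccontr)
  assume "\<not> 1 \<le> rank Q \<pi>"
  then have none: "handled i (pending i) = []" if "i < length \<pi>" for i
    using handled_beyond_rank that by simp
  have "pending i = pending 0" if "i \<le> length \<pi>" for i
    using that
  proof (induction i)
    case (Suc i)
    then show ?case using none[of i] by (simp add: pending_Suc)
  qed simp
  from this[of "length \<pi>"] have "Q = []" by (simp add: pending_length pending_0)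
  with query show False by (simp add: full_query_def)
qed

end

locale boxed_lftj_bounds = boxed_lftj_input +
  fixes a I :: nat
  assumes arity_le: "\<And>j. j < length Q \<Longrightarrow> ar (symbol j) \<le> a"
    and words_le: "\<And>j. j < length Q \<Longrightarrow> trie_words (ar (symbol j)) (rel j) \<le> I"
    and memory_pos: "0 < dimension_memory"
begin

definition iteration_cost :: nat where
  "iteration_cost = 4 * length Q * a * Suc (length \<pi> * dimension_memory div B)"

definition max_iterations :: real where
  "max_iterations = 1 + real (2 * length Q * I) / iteration_nodes"

text \<open>A closed form dominating the recurrence T(i) = N * (c + T(i + 1)), with T = 0 from the
  rank on, where N is \<open>max_iterations\<close> and c is \<open>iteration_cost\<close>.
  Truncated subtraction provides the zero.\<close>

definition dimension_cost :: "nat \<Rightarrow> real" where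
  "dimension_cost i = real (rank Q \<pi> - i) * iteration_cost * max_iterations ^ (rank Q \<pi> - i)"

lemma iteration_nodes_pos: "0 < iteration_nodes"
  using memory_pos query by (simp add: iteration_nodes_def full_query_def)

lemma max_iterations_ge: "1 \<le> max_iterations"
  using iteration_nodes_pos by (simp add: max_iterations_def)

lemma dimension_cost_nonneg: "0 \<le> dimension_cost i"
  using max_iterations_ge by (simp add: dimension_cost_def)

lemma dimension_cost_Suc:
  assumes "i < rank Q \<pi>"
  shows "max_iterations * (iteration_cost + dimension_cost (Suc i)) \<le> dimension_cost i"
proof -
  obtain d where d: "rank Q \<pi> - i = Suc d" using assms by (metis Suc_diff_Suc)
  then have d': "rank Q \<pi> - Suc i = d" by simp
  have "max_iterations * iteration_cost \<le> max_iterations ^ Suc d * iteration_cost"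
    using max_iterations_ge by (intro mult_right_mono self_le_power) auto
  then show ?thesis unfolding dimension_cost_def d d' by (simp add: algebra_simps)
qed

text \<open>Needed for dimensions without atoms, which can also occur below the rank: they make one
  call and read nothing themselves.\<close>

lemma dimension_cost_antimono: "dimension_cost (Suc i) \<le> dimension_cost i"
proof (cases "i < rank Q \<pi>")
  case True
  have "dimension_cost (Suc i) \<le> iteration_cost + dimension_cost (Suc i)" by simp
  also have "\<dots> \<le> max_iterations * (iteration_cost + dimension_cost (Suc i))"
    using max_iterations_ge dimension_cost_nonneg[of "Suc i"] by (simp add: mult_le_cancel_right1)
  also have "\<dots> \<le> dimension_cost i" by (rule dimension_cost_Suc[OF True])
  finally show ?thesis .
qed (simp add: dimension_cost_def)

lemma reads_iteration_le:
  assumes "spilled i (pending i) w low = []" "i < length \<pi>" "w \<le> Suc i * dimension_memory"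
  shows "reads (probe_events i (pending i) w low) + reads (provision_events i (pending i) w low cache)
    \<le> (if handled i (pending i) = [] then 0 else iteration_cost)"
proof -
  let ?l = "length (handled i (pending i))"
  note r = reads_iteration[OF assms(1) arity_le, of cache]
  have "w \<le> length \<pi> * dimension_memory"
    using assms(2,3) by (meson Suc_leI mult_le_mono1 order.trans)
  have "budget i (pending i) w \<le> length \<pi> * dimension_memory div B" if "0 < ?l"
  proof -
    have "budget i (pending i) w = w div B div ?l"
      by (simp add: budget_def div_mult2_eq mult.commute)
    also have "\<dots> \<le> w div B" by simp
    also have "\<dots> \<le> length \<pi> * dimension_memory div B"
      using \<open>w \<le> length \<pi> * dimension_memory\<close> by (rule div_le_mono)
    finally show ?thesis .
  qed
  then have "?l * (4 * a * Suc (budget i (pending i) w)) \<le>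
      length Q * (4 * a * Suc (length \<pi> * dimension_memory div B))"
    using length_handled_le by (cases "0 < ?l") (auto intro!: mult_le_mono)
  also have "\<dots> = iteration_cost"
    unfolding iteration_cost_def by (simp only: mult_ac)
  finally have "?l * (4 * a * Suc (budget i (pending i) w)) \<le> iteration_cost" .
  with r show ?thesis by auto
qed

text \<open>The bounds on \<open>w\<close> follow the memory passed on: each step adds at most what
  the previous dimension had. In the loop, one plus \<open>nodes_left\<close> divided by
  \<open>iteration_nodes\<close> bounds the iterations still to come.\<close>

lemma
  box_up_reads: "box_up i todo P w tr \<Longrightarrow> todo = pending i \<Longrightarrow> spill_free tr \<Longrightarrow>
    dimension_memory \<le> w \<Longrightarrow> w \<le> Suc i * dimension_memory \<Longrightarrow>
    reads tr \<le> dimension_cost i"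
  and box_loop_reads: "box_loop i todo P w low cache tr \<Longrightarrow> todo = pending i \<Longrightarrow> spill_free tr \<Longrightarrow>
    dimension_memory \<le> w \<Longrightarrow> w \<le> Suc i * dimension_memory \<Longrightarrow> i < length \<pi> \<Longrightarrow>
    reads tr \<le> (if handled i todo = [] then dimension_cost (Suc i)
      else (1 + nodes_left i low / iteration_nodes) * (iteration_cost + dimension_cost (Suc i)))"
proof (induction rule: box_up_box_loop.inducts)
  case (join todo P w)
  then show ?case using dimension_cost_nonneg by simp
next
  case (pass i todo P w tr)
  then have reads: "reads tr \<le> (if handled i todo = [] then dimension_cost (Suc i)
      else (1 + nodes_left i Minf / iteration_nodes) * (iteration_cost + dimension_cost (Suc i)))"
    by simp
  show ?case
  proof (cases "handled i todo = []")
    case True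
    then show ?thesis using reads dimension_cost_antimono[of i] by simp
  next
    case False
    then have "i < rank Q \<pi>" using handled_beyond_rank pass by (meson not_le)
    have "real (nodes_left i Minf) \<le> real (2 * length Q * I)"
      using nodes_left_le[OF words_le] by (rule of_nat_mono)
    then have "1 + nodes_left i Minf / iteration_nodes \<le> max_iterations"
      using iteration_nodes_pos by (simp add: max_iterations_def divide_right_mono)
    then have "(1 + nodes_left i Minf / iteration_nodes) * (iteration_cost + dimension_cost (Suc i))
        \<le> max_iterations * (iteration_cost + dimension_cost (Suc i))"
      using dimension_cost_nonneg by (intro mult_right_mono) auto
    with reads False dimension_cost_Suc[OF \<open>i < rank Q \<pi>\<close>] show ?thesis by simp
  qed
next
  case (last i todo w low e P tr cache)
  have sp: "spilled i (pending i) w low = []"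
    using box_loop_not_spilled[OF box_up_box_loop.last[OF last.IH(1,2,3,5)]] last.prems by blast
  have IH: "reads tr \<le> dimension_cost (Suc i)"
    using last sp by (simp add: remaining_pending)
  \<comment> \<open>The summand 1 of the claimed factor pays for this final iteration.\<close>
  have "0 \<le> nodes_left i low / iteration_nodes * (iteration_cost + dimension_cost (Suc i))"
    using iteration_nodes_pos dimension_cost_nonneg by simp
  with IH reads_iteration_le[OF sp last.prems(5,4), of cache] last.prems(1) show ?case
    by (auto simp: algebra_simps split: if_splits)
next
  case (iterate i todo w low e P tr h cache tr')
  have sp: "spilled i (pending i) w low = []"
    using box_loop_not_spilled[OF box_up_box_loop.iterate[OF iterate.IH(1,2,3,5,6)]] iterate.prems by blast
  have sp': "spilled i (pending i) w (Fin (h + 1)) = []"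
    using box_loop_not_spilled[OF iterate.IH(6)] iterate.prems by auto
  have handled: "handled i todo \<noteq> []"
    using high_no_atoms[of i todo w low] iterate.IH(5) by auto
  let ?c = "iteration_cost + dimension_cost (Suc i)"
  have "reads tr \<le> dimension_cost (Suc i)"
    using iterate sp by (simp add: remaining_pending)
  moreover have "reads tr' \<le> (1 + nodes_left i (Fin (h + 1)) / iteration_nodes) * ?c"
    using iterate handled by simp
  moreover have "reads (probe_events i todo w low) + reads (provision_events i todo w low cache)
      \<le> iteration_cost"
    using reads_iteration_le[OF sp iterate.prems(5,4), of cache] handled iterate.prems(1) by simp
  ultimately have "reads (probe_events i todo w low @ provision_events i todo w low cache @ tr @ tr')
      \<le> (1 + (1 + nodes_left i (Fin (h + 1)) / iteration_nodes)) * ?c"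
    by (simp add: algebra_simps)
  also have "1 + nodes_left i (Fin (h + 1)) / iteration_nodes \<le> nodes_left i low / iteration_nodes"
  proof -
    have "iteration_nodes + nodes_left i (Fin (h + 1)) \<le> nodes_left i low"
      using nodes_left_decrease[OF sp _ sp'] iterate.prems(1,3) iterate.IH(5) by simp
    from divide_right_mono[OF this less_imp_le[OF iteration_nodes_pos]] iteration_nodes_pos
    show ?thesis by (simp add: add_divide_distrib)
  qed
  then have "(1 + (1 + nodes_left i (Fin (h + 1)) / iteration_nodes)) * ?c
      \<le> (1 + nodes_left i low / iteration_nodes) * ?c"
    using dimension_cost_nonneg by (intro mult_right_mono) auto
  finally show ?case using handled by simp
qed

lemma reads_le:
  assumes "execution tr" "spill_free tr"
  shows "reads tr \<le> rank Q \<pi> * iteration_cost * max_iterations ^ rank Q \<pi>"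
  using box_up_reads[OF assms(1)[unfolded execution_def] pending_0[symmetric] assms(2)]
  by (simp add: dimension_cost_def)

end

section \<open>The bound\<close>

text \<open>Every variable occurs in an atom, so the memory assumption, phrased by atoms and arity,
  also controls the number of dimensions.\<close>

lemma length_key_order_le:
  assumes "full_query ar Q \<pi>"
  shows "0 < length \<pi>" "length \<pi> \<le> length Q * Max (ar ` fst ` set Q)"
proof -
  have set_pi: "set \<pi> = (\<Union>A\<in>set Q. set (snd A))" and "distinct \<pi>"
    using assms by (auto simp: full_query_def)
  obtain A where A: "A \<in> set Q" using assms by (cases Q) (auto simp: full_query_def)
  then have "snd A \<noteq> []" using assms by (auto simp: full_query_def)
  with A set_pi show "0 < length \<pi>" by (cases "snd A") auto
  have "length \<pi> = card (\<Union>A\<in>set Q. set (snd A))"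
    using distinct_card[OF \<open>distinct \<pi>\<close>] set_pi by simp
  also have "\<dots> \<le> (\<Sum>A\<in>set Q. card (set (snd A)))" by (rule card_UN_le) simp
  also have "\<dots> \<le> (\<Sum>A\<in>set Q. Max (ar ` fst ` set Q))"
  proof (rule sum_mono)
    fix A assume A: "A \<in> set Q"
    have "card (set (snd A)) \<le> length (snd A)" by (rule card_length)
    also have "\<dots> = ar (fst A)" using A assms by (auto simp: full_query_def)
    also have "\<dots> \<le> Max (ar ` fst ` set Q)" using A by (intro Max_ge) auto
    finally show "card (set (snd A)) \<le> Max (ar ` fst ` set Q)" .
  qed
  also have "\<dots> \<le> length Q * Max (ar ` fst ` set Q)"
    using card_length[of Q] by simp
  finally show "length \<pi> \<le> length Q * Max (ar ` fst ` set Q)" .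
qed

lemma (in boxed_lftj) dimension_memory_bounds:
  assumes query: "full_query ar Q \<pi>" and "0 < B"
    and M: "10 * (length Q * Max (ar ` fst ` set Q) * B) < M"
  shows "0 < dimension_memory" "M \<le> 10 * length \<pi> * dimension_memory"
    "length \<pi> * dimension_memory \<le> M"
proof -
  define a where "a = Max (ar ` fst ` set Q)"
  define s where "s = (\<Sum>(R, xs)\<leftarrow>Q. 4 * (2 * ar R - 1))"
  define M' where "M' = M - (1 + s) * B"
  note len = length_key_order_le[OF query, folded a_def]
  have "0 < length Q * a" using len by linarith
  have "s \<le> (\<Sum>_\<leftarrow>Q. 8 * a - 4)"
    unfolding s_def
  proof (rule sum_list_mono, clarify)
    fix R xs assume "(R, xs) \<in> set Q"
    then have "ar R \<le> a" unfolding a_def by (intro Max_ge) force+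
    then show "4 * (2 * ar R - 1) \<le> 8 * a - 4" by simp
  qed
  also have "\<dots> = length Q * (8 * a - 4)" by (simp add: sum_list_triv)
  also have "\<dots> = 8 * (length Q * a) - 4 * length Q" by (simp add: diff_mult_distrib2)
  finally have "1 + s \<le> 8 * (length Q * a)"
    using \<open>0 < length Q * a\<close> by (cases "length Q") auto
  then have "(1 + s) * B \<le> 8 * (length Q * a * B)"
    using mult_le_mono1[of "1 + s" "8 * (length Q * a)" B] by (simp only: mult.assoc)
  \<comment> \<open>The reserved blocks take at most 8 of the more than 10 units
    \<open>length Q * a * B\<close> in \<open>M\<close>, which leaves at least a fifth of
    \<open>M\<close>.\<close>
  with M have M': "M \<le> 5 * M'" "2 * (length Q * a * B) \<le> M'"
    unfolding M'_def a_def[symmetric] by linarith+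
  have dm: "dimension_memory = M' div length \<pi>"
    by (simp add: dimension_memory_def M'_def s_def)
  have "length \<pi> \<le> length Q * a * B"
    using len(2) \<open>0 < B\<close> by (metis One_nat_def Suc_leI mult.right_neutral mult_le_mono)
  with M'(2) have "length \<pi> \<le> M'" by linarith
  with len(1) show pos: "0 < dimension_memory" by (simp add: dm div_greater_zero_iff)
  have "M' < Suc dimension_memory * length \<pi>"
    unfolding dm using len(1) by (metis dividend_less_div_times mult_Suc add.commute)
  \<comment> \<open>Rounding the division among the dimensions costs a factor 2, which turns 5 into
    10.\<close>
  also have "\<dots> \<le> 2 * dimension_memory * length \<pi>" using pos by (intro mult_le_mono1) simp
  finally show "M \<le> 10 * length \<pi> * dimension_memory" using M'(1) by (simp add: algebra_simps)
  have "length \<pi> * dimension_memory \<le> M'" unfolding dm by (rule times_div_less_eq_dividend)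
  then show "length \<pi> * dimension_memory \<le> M" by (simp add: M'_def)
qed

theorem theorem13:
  fixes Q :: "('r, 'v) atom list" and \<pi> :: "'v list" and ar :: "'r \<Rightarrow> nat"
  assumes "full_query ar Q \<pi>"
  shows "\<exists>C>0::real. \<forall>(D :: 'r \<Rightarrow> int list set) (M :: nat) (B :: nat) tr.
    database ar Q D \<longrightarrow>
    0 < B \<longrightarrow>
    real (input_size ar Q D) / real B > log 2 (real (input_size ar Q D)) \<longrightarrow>
    real M / real B > 10 * real (length Q) * real (Max (ar ` fst ` set Q)) \<longrightarrow>
    M \<le> input_size ar Q D \<longrightarrow>
    boxed_lftj.execution Q \<pi> ar D M B tr \<longrightarrow>
    spill_free tr \<longrightarrow>
    real (io_cost (length \<pi>) B tr) \<le>
      C * (real (input_size ar Q D) ^ rank Q \<pi> / (real M ^ (rank Q \<pi> - 1) * real B)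
           + real (card (answers Q \<pi> D)) / real B)"
proof -
  define a m n l where "a = Max (ar ` fst ` set Q)" and "m = length Q" and "n = length \<pi>"
    and "l = rank Q \<pi>"
  \<comment> \<open>A pass has at most 1 + 2 m I / \<open>iteration_nodes\<close> = 1 + 8 m^2 I /
    \<open>dimension_memory\<close> iterations; \<open>dimension_memory\<close> is at least M / (10
    n), which gives 80.\<close>
  define c where "c = 1 + 80 * real m ^ 2 * real n"
  \<comment> \<open>\<open>iteration_cost\<close> is at most 8 m a M / B, twice 4 m a because M / B
    absorbs the extra boundary block. The \<open>n\<close> is the width of an output tuple, the
    \<open>1\<close> the last output block.\<close>
  define C where "C = real l * (8 * real m * real a) * c ^ l + real n + 1"
  have "0 < C" by (simp add: C_def c_def add_nonneg_pos)
  have "real (io_cost n B tr) \<le>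
      C * (real (input_size ar Q D) ^ l / (real M ^ (l - 1) * real B)
           + real (card (answers Q \<pi> D)) / real B)"
    if db: "database ar Q D" and B: "0 < B"
      and memory: "real M / real B > 10 * real (length Q) * real (Max (ar ` fst ` set Q))"
      and input: "M \<le> input_size ar Q D"
      and exec: "boxed_lftj.execution Q \<pi> ar D M B tr" and sf: "spill_free tr"
    for D :: "'r \<Rightarrow> int list set" and M B tr
  proof -
    interpret boxed_lftj_input Q \<pi> ar D M B
      using assms db B by unfold_locales
    define I where "I = input_size ar Q D"
    have "10 * real m * real a * real B < real M"
      using memory B by (simp add: m_def a_def pos_less_divide_eq)
    then have "real (10 * (m * a * B)) < real M" by simp
    then have M: "10 * (m * a * B) < M" by (simp only: of_nat_less_iff)
    note dm = dimension_memory_bounds[OF assms B M[unfolded m_def a_def], folded n_def]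
    interpret boxed_lftj_bounds Q \<pi> ar D M B a I
    proof unfold_locales
      fix j assume "j < length Q"
      then have "symbol j \<in> fst ` set Q" by (simp add: symbol_def)
      then show "ar (symbol j) \<le> a" unfolding a_def by (intro Max_ge) auto
      show "trie_words (ar (symbol j)) (rel j) \<le> I"
        unfolding I_def input_size_def rel_def using \<open>symbol j \<in> fst ` set Q\<close>
        by (intro member_le_sum[of "symbol j" _ "\<lambda>R. trie_words (ar R) (D R)"]) auto
    qed (rule dm(1))
    define X where "X = real I / real M"
    have "0 < M" using M by simp
    have "B \<le> M"
    proof -
      have "0 < m * a" using length_key_order_le[OF assms, folded m_def a_def] by linarith
      then have "B \<le> 10 * (m * a * B)" by simp
      with M show ?thesis by linarith
    qed
    have "1 \<le> X" using input \<open>0 < M\<close> by (simp add: X_def I_def)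
    have "1 \<le> l" using rank_pos by (simp add: l_def)
    have rhs: "real M / real B * X ^ l = real I ^ l / (real M ^ (l - 1) * real B)"
    proof -
      have "real M ^ l = real M * real M ^ (l - 1)" using \<open>1 \<le> l\<close> by (simp add: power_eq_if)
      then show ?thesis using \<open>0 < M\<close> by (simp add: X_def power_divide)
    qed
    have "real (n * dimension_memory div B) \<le> real (n * dimension_memory) / real B"
      by (rule of_nat_div_le_of_nat)
    also have "\<dots> \<le> real M / real B" using dm(3) by (intro divide_right_mono) (auto simp flip: of_nat_mult)
    finally have "real (Suc (n * dimension_memory div B)) \<le> 1 + real M / real B" by simp
    also have "\<dots> \<le> 2 * (real M / real B)" using \<open>B \<le> M\<close> B by (simp add: field_simps)
    finally have "4 * real m * real a * real (Suc (n * dimension_memory div B)) \<le>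
        4 * real m * real a * (2 * (real M / real B))"
      by (intro mult_left_mono) auto
    moreover have "real iteration_cost =
        4 * real m * real a * real (Suc (n * dimension_memory div B))"
      by (simp only: iteration_cost_def m_def n_def of_nat_mult of_nat_numeral)
    moreover have "4 * real m * real a * (2 * (real M / real B)) =
        8 * real m * real a * (real M / real B)"
      by simp
    ultimately have cost: "real iteration_cost \<le> 8 * real m * real a * (real M / real B)"
      by (simp only:)
    have "real M \<le> 10 * real n * real dimension_memory"
      using of_nat_mono[OF dm(2), where ?'a = real] by simp
    then have "1 / real dimension_memory \<le> 10 * real n / real M"
      using \<open>0 < M\<close> dm(1) by (simp add: field_simps)
    then have "8 * real m ^ 2 * real I * (1 / real dimension_memory) \<le>
        8 * real m ^ 2 * real I * (10 * real n / real M)"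
      by (intro mult_left_mono) auto
    moreover have "max_iterations = 1 + 8 * real m ^ 2 * real I * (1 / real dimension_memory)"
      by (simp add: max_iterations_def iteration_nodes_def m_def power2_eq_square)
    ultimately have "max_iterations \<le> 1 + 80 * real m ^ 2 * real n * X"
      by (simp add: X_def mult_ac)
    also have "\<dots> \<le> c * X" using \<open>1 \<le> X\<close> by (simp add: c_def algebra_simps)
    finally have "max_iterations ^ l \<le> (c * X) ^ l"
      using max_iterations_ge by (intro power_mono) auto
    with cost have "real l * real iteration_cost * max_iterations ^ l \<le>
        real l * (8 * real m * real a * (real M / real B)) * (c * X) ^ l"
      using max_iterations_ge by (intro mult_mono) auto
    with reads_le[OF exec sf] have "real (reads tr) \<le>
        real l * (8 * real m * real a * (real M / real B)) * (c * X) ^ l"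
      by (simp add: l_def)
    also have "\<dots> = real l * (8 * real m * real a) * c ^ l * (real M / real B * X ^ l)"
      by (simp add: power_mult_distrib mult_ac)
    finally have reads: "real (reads tr) \<le>
        real l * (8 * real m * real a) * c ^ l * (real M / real B * X ^ l)" .
    define K where "K = card (answers Q \<pi> D)"
    have "real (nat \<lceil>real (n * length (outputs tr)) / real B\<rceil>) \<le>
        real (n * length (outputs tr)) / real B + 1"
      using of_int_ceiling_le_add_one[of "real (n * length (outputs tr)) / real B"] by simp
    also have "\<dots> \<le> real n * (real K / real B) + 1"
      using length_outputs_le[OF exec sf] by (simp add: K_def divide_right_mono mult_left_mono)
    \<comment> \<open>The partly filled last output block is charged to the input term, which is at
      least 1 since \<open>B \<le> M\<close> and \<open>1 \<le> X\<close>.\<close>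
    also have "\<dots> \<le> real n * (real K / real B) + real M / real B * X ^ l"
      using \<open>B \<le> M\<close> B \<open>1 \<le> X\<close> by (intro add_left_mono mult_ge1_I) auto
    finally have written: "real (nat \<lceil>real (n * length (outputs tr)) / real B\<rceil>) \<le>
        real n * (real K / real B) + real M / real B * X ^ l" .
    have "real (io_cost n B tr) = real (reads tr) + real (nat \<lceil>real (n * length (outputs tr)) / real B\<rceil>)"
      by (simp add: io_cost_def reads_def length_outputs)
    also have "\<dots> \<le> (real l * (8 * real m * real a) * c ^ l + 1) * (real M / real B * X ^ l) +
        real n * (real K / real B)"
      using add_mono[OF reads written] by (simp only: distrib_right mult_1_left add_ac)
    also have "\<dots> \<le> C * (real M / real B * X ^ l) + C * (real K / real B)"
      using \<open>1 \<le> X\<close> unfolding C_def c_def by (intro add_mono mult_right_mono) auto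
    also have "\<dots> = C * (real I ^ l / (real M ^ (l - 1) * real B) + real K / real B)"
      unfolding rhs by (rule distrib_left[symmetric])
    finally show ?thesis unfolding I_def K_def .
  qed
  with \<open>0 < C\<close> show ?thesis unfolding n_def l_def by blast
qed

end
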